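(* Assume that there exist constants $C,\lambda>0$ and $\zeta\in(0,1]$, $\sigma_\epsilon$-invariant measurable sets $\Omega_\epsilon\subset\Omega$, $\epsilon\in I$, with $\mathbb P_\epsilon(\Omega_\epsilon)=1$, and for each $\epsilon\in I$ a family $(h_{\omega,\epsilon})_{\omega\in\Omega_\epsilon}\subset\mathcal B_s$ such that: (1) $\|\mathcal L_{\omega,\epsilon}^n h\|_w\le Ce^{-\lambda n}\|h\|_w$ for all $h\in\mathcal B_w$ with $\psi(h)=0$, $n\in\mathbb N$, $\epsilon\in I$, $\omega\in\Omega_\epsilon$; (2) $\|\mathcal L_{\omega,\epsilon}h-\mathcal L_{\omega'}h\|_w\le C\left(d(\omega,\omega')^\zeta+|\epsilon|^\zeta\right)\|h\|_s$ for all $\epsilon\in I$, $h\in\mathcal B_s$, $\omega\in\Omega_\epsilon$, $\omega'\in\Omega_0$; (3) $\psi(h_{\omega,\epsilon})=1$ and $\|h_{\omega,\epsilon}\|_s\le C$ for all $\epsilon\in I$, $\omega\in\Omega_\epsilon$; (4) $\mathcal L_{\omega,\epsilon}h_{\omega,\epsilon}=h_{\sigma_\epsilon\omega,\epsilon}$ for all $\epsilon\in I$, $\omega\in\Omega_\epsilon$; (5) $\sigma^{-1}$ is Lipschitz continuous. Assume that there is a measurable set $\Omega'$ such that $\Omega'\subset\Omega_\epsilon$ and $\mathbb P_\epsilon(\Omega')=1$ for every $\epsilon\in I$. Suppose that the $h_{\omega,\epsilon}$ are Borel probability measures on $M$ (in case (H)), respectively probability densities with respect to $m$ (in case (E)),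 depending measurably on $\omega$ for each $\epsilon\in I$, and that $$\lim_{\epsilon\to0}\|\mathbb P_\epsilon-\mathbb P_0\|_{\mathfrak F}=0\quad\text{and}\quad\lim_{\epsilon\to0}\mathrm{dist}_{C^0}(\sigma^{-1},\sigma_\epsilon^{-1})=0.$$ Let $\Phi:\Omega\times M\to\mathbb R$ be measurable with $\Phi(\omega,\cdot)\in C^r(M,\mathbb R)$ in case (H), respectively $\Phi(\omega,\cdot)\in L^1(m)$ in case (E), for each $\omega$, and suppose that the functions $\varphi,\theta:\Omega\to\mathbb R$ given by $$\varphi(\omega):=h_\omega(\Phi(\omega,\cdot)),\qquad \theta(\omega):=\|\Phi(\omega,\cdot)\|_{C^r}\ \text{ in case (H)},\qquad \theta(\omega):=\int_M|\Phi(\omega,\cdot)|\,dm\ \text{ in case (E)},$$ belong to $\mathfrak F$, where $h_\omega:=h_{\omega,0}$. Then $$\lim_{\epsilon\to0}\int_{\Omega\times M}\Phi\,d\mu_\epsilon=\int_{\Omega\times M}\Phi\,d\mu,$$ where $\mu_\epsilon$ is the measure on $\Omega\times M$ with $\mu_\epsilon(A\times B)=\int_A h_{\omega,\epsilon}(B)\,d\mathbb P_\epsilon(\omega)$ for measurable $A\subset\Omega$, $B\subset M$, and $\mu:=\mu_0$.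
   Context: $\Omega$ is a bounded metric space with metric $d$, and $I\subset\mathbb R$ is a set containing $0$, with $0$ an accumulation point of $I$. For each $\epsilon\in I$, $\sigma_\epsilon:\Omega\to\Omega$ is a homeomorphism and $\mathbb P_\epsilon$ is a $\sigma_\epsilon$-invariant Borel probability measure on $\Omega$. The map $(\omega,\epsilon)\mapsto\sigma_\epsilon\omega$ is continuous. Write $\sigma=\sigma_0$ and $\mathrm{dist}_{C^0}(\sigma^{-1},\sigma_\epsilon^{-1}):=\sup_{y\in\Omega}d(\sigma^{-1}(y),\sigma_\epsilon^{-1}(y))$. $(\mathcal B_w,\|\cdot\|_w)$ and $(\mathcal B_s,\|\cdot\|_s)$ are Banach spaces such that $\mathcal B_s$ is embedded in $\mathcal B_w$ and $\|\cdot\|_w\le\|\cdot\|_s$ on $\mathcal B_s$. $\psi$ is a non-zero bounded linear functional on $\mathcal B_s$ admitting a bounded extension to $\mathcal B_w$ (still denoted $\psi$). For each $\omega\in\Omega$, $\epsilon\in I$, $\mathcal L_{\omega,\epsilon}$ is a bounded linear operator on both $\mathcal B_s$ and $\mathcal B_w$, and $\psi(\mathcal L_{\omega,\epsilon}h)=\psi(h)$ for all $h\in\mathcal B_w$. For $n\in\mathbb N$, $\mathcal L_{\omega,\epsilon}^n:=\mathcal L_{\sigma_\epsilon^{n-1}\omega,\epsilon}\circ\cdots\circ\mathcal L_{\sigma_\epsilon\omega,\epsilon}\circ\mathcal L_{\omega,\epsilon}$, and $\mathcal L_\omega:=\mathcal L_{\omega,0}$. $M$ is a compact Riemannian manifold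 and $m$ is its normalized volume measure. One of two cases is assumed: - Case (E): the elements of $\mathcal B_w$ are bounded measurable functions on $M$ and $\|\cdot\|_\infty\le\|\cdot\|_w$. For functions $g,h$ on $M$ write $h(g)=\int_M g\,h\,dm$ (and $h(B)=\int_B h\,dm$ for a Borel set $B$). - Case (H): there is $r\in\mathbb N$ such that the elements of $\mathcal B_w$ are distributions of order $r$ on $M$, i.e. there is a constant $C>0$ with $|h(\varphi)|\le C\|h\|_w\|\varphi\|_{C^r}$ for all $h\in\mathcal B_w$ and $\varphi\in C^r(M,\mathbb C)$. When $h$ is a Borel measure, $h(\varphi)=\int\varphi\,dh$. $(\mathfrak F,\|\cdot\|_{\mathfrak F})$ is a semi-normed space of bounded measurable real-valued functions on $\Omega$ such that $\sup_{\epsilon\in I}\sup_{f\in\mathfrak F,\|f\|_{\mathfrak F}\le1}\left|\int_\Omega f\,d\mathbb P_\epsilon\right|<\infty$. For a finite signed Borel measure $\nu$ on $\Omega$, $\|\nu\|_{\mathfrak F}:=\sup_{f\in\mathfrak F,\|f\|_{\mathfrak F}\le1}\left|\int_\Omega f\,d\nu\right|$. Since $h_\omega$ is defined for $\omega\in\Omega_0$, the formula for $\varphi$ is understood for $\omega\in\Omega_0$ (values outside this set being irrelevant as long as the resulting function lies in $\mathfrak F$). *)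

theory Defs
  imports "HOL-Probability.Probability"
begin

section \<open>Compact Riemannian manifolds, their volume measure, and functions of class C^r\<close>

text \<open>
  The manifold is the whole type \<open>'m\<close>. A chart is a pair \<open>(U, x)\<close> of an open
  domain and a coordinate map; its inverse is \<open>inv_into U x\<close>.
\<close>

type_synonym ('m, 'n) chart = "'m set \<times> ('m \<Rightarrow> real ^ 'n)"

text \<open>
  Class C^k on an open subset of Euclidean space. By induction on \<open>k\<close>, this says that all
  partial derivatives of order at most \<open>k\<close> exist and are continuous.
\<close>

primrec Ck_on :: "nat \<Rightarrow> (real ^ 'n) set \<Rightarrow> (real ^ 'n \<Rightarrow> 'b::real_normed_vector) \<Rightarrow> bool" where
  "Ck_on 0 S f \<longleftrightarrow> continuous_on S f"
| "Ck_on (Suc k) S f \<longleftrightarrow>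
     (\<forall>z\<in>S. f differentiable (at z)) \<and>
     (\<forall>j. Ck_on k S (\<lambda>z. frechet_derivative f (at z) (axis j 1)))"

definition smooth_on :: "(real ^ 'n) set \<Rightarrow> (real ^ 'n \<Rightarrow> 'b::real_normed_vector) \<Rightarrow> bool" where
  "smooth_on S f \<longleftrightarrow> (\<forall>k. Ck_on k S f)"

primrec iter_partial ::
  "'n list \<Rightarrow> (real ^ 'n \<Rightarrow> 'b::real_normed_vector) \<Rightarrow> real ^ 'n \<Rightarrow> 'b" where
  "iter_partial [] f = f"
| "iter_partial (j # js) f = (\<lambda>z. frechet_derivative (iter_partial js f) (at z) (axis j 1))"

definition smooth_atlas ::
  "('m::{t2_space, second_countable_topology}, 'n::finite) chart set \<Rightarrow> bool" where
  "smooth_atlas \<A> \<longleftrightarrow>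
     (\<Union>(U, x)\<in>\<A>. U) = UNIV \<and>
     (\<forall>(U, x)\<in>\<A>. open U \<and> open (x ` U) \<and> homeomorphism U (x ` U) x (inv_into U x)) \<and>
     (\<forall>(U, x)\<in>\<A>. \<forall>(V, y)\<in>\<A>. smooth_on (x ` (U \<inter> V)) (y \<circ> inv_into U x))"

text \<open>
  A Riemannian metric is given by its coordinate expressions: \<open>g (U, x) p u v\<close> is the inner
  product at \<open>p \<in> U\<close> of the tangent vectors with components \<open>u\<close>, \<open>v\<close> in the chart \<open>(U, x)\<close>.
  The last clause is the transformation rule under a change of coordinates.
\<close>

definition riemannian_metric ::
  "('m::{t2_space, second_countable_topology}, 'n::finite) chart set \<Rightarrow>
   (('m, 'n) chart \<Rightarrow> 'm \<Rightarrow> real ^ 'n \<Rightarrow> real ^ 'n \<Rightarrow> real) \<Rightarrow> bool" where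
  "riemannian_metric \<A> g \<longleftrightarrow>
     (\<forall>(U, x)\<in>\<A>. \<forall>p\<in>U.
        bilinear (g (U, x) p) \<and>
        (\<forall>u v. g (U, x) p u v = g (U, x) p v u) \<and>
        (\<forall>u. u \<noteq> 0 \<longrightarrow> g (U, x) p u u > 0)) \<and>
     (\<forall>(U, x)\<in>\<A>. \<forall>u v. smooth_on (x ` U) (\<lambda>z. g (U, x) (inv_into U x z) u v)) \<and>
     (\<forall>(U, x)\<in>\<A>. \<forall>(V, y)\<in>\<A>. \<forall>p\<in>U \<inter> V. \<forall>u v.
        let D = frechet_derivative (y \<circ> inv_into U x) (at (x p))
        in g (V, y) p (D u) (D v) = g (U, x) p u v)"

definition compact_riemannian_manifold ::
  "('m::{t2_space, second_countable_topology}, 'n::finite) chart set \<Rightarrow>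
   (('m, 'n) chart \<Rightarrow> 'm \<Rightarrow> real ^ 'n \<Rightarrow> real ^ 'n \<Rightarrow> real) \<Rightarrow> bool" where
  "compact_riemannian_manifold \<A> g \<longleftrightarrow>
     compact (UNIV :: 'm set) \<and> smooth_atlas \<A> \<and> riemannian_metric \<A> g"

text \<open>
  The Riemannian volume is the Borel measure that has density \<open>sqrt (det (g_ij))\<close> with respect
  to Lebesgue measure in every chart; this determines it uniquely.
\<close>

definition volume_density ::
  "(('m, 'n::finite) chart \<Rightarrow> 'm \<Rightarrow> real ^ 'n \<Rightarrow> real ^ 'n \<Rightarrow> real) \<Rightarrow>
   ('m, 'n) chart \<Rightarrow> 'm \<Rightarrow> real" where
  "volume_density g c p = sqrt (det (\<chi> i j. g c p (axis i 1) (axis j 1)))"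

definition riemannian_volume ::
  "('m::{t2_space, second_countable_topology}, 'n::finite) chart set \<Rightarrow>
   (('m, 'n) chart \<Rightarrow> 'm \<Rightarrow> real ^ 'n \<Rightarrow> real ^ 'n \<Rightarrow> real) \<Rightarrow> 'm measure \<Rightarrow> bool" where
  "riemannian_volume \<A> g V \<longleftrightarrow>
     sets V = sets borel \<and>
     (\<forall>(U, x)\<in>\<A>. \<forall>B\<in>sets borel. B \<subseteq> U \<longrightarrow>
        emeasure V B =
          (\<integral>\<^sup>+z\<in>x ` B. ennreal (volume_density g (U, x) (inv_into U x z)) \<partial>lborel))"

definition normalized_volume ::
  "('m::{t2_space, second_countable_topology}, 'n::finite) chart set \<Rightarrow>
   (('m, 'n) chart \<Rightarrow> 'm \<Rightarrow> real ^ 'n \<Rightarrow> real ^ 'n \<Rightarrow> real) \<Rightarrow> 'm measure \<Rightarrow> bool" where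
  "normalized_volume \<A> g m \<longleftrightarrow> (\<exists>V. riemannian_volume \<A> g V \<and> m = uniform_measure V UNIV)"

definition Cr_funs ::
  "('m::{t2_space, second_countable_topology}, 'n::finite) chart set \<Rightarrow> nat \<Rightarrow>
   ('m \<Rightarrow> 'b::real_normed_vector) set" where
  "Cr_funs \<A> r = {f. \<forall>(U, x)\<in>\<A>. Ck_on r (x ` U) (f \<circ> inv_into U x)}"

text \<open>
  On a compact manifold the C^r norm is defined up to equivalence: one takes a finite cover by
  compact sets lying in chart domains and adds up the suprema of the partial derivatives of order
  at most \<open>r\<close> in these coordinates. \<open>Cr_norm\<close> admits every norm equivalent to
  such a sum, which includes the one built from covariant derivatives of the metric.
\<close>

definition chart_cover ::
  "('m::{t2_space, second_countable_topology}, 'n::finite) chart set \<Rightarrow>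
   (('m, 'n) chart \<times> 'm set) set \<Rightarrow> bool" where
  "chart_cover \<A> \<K> \<longleftrightarrow>
     finite \<K> \<and>
     (\<forall>((U, x), K)\<in>\<K>. (U, x) \<in> \<A> \<and> compact K \<and> K \<noteq> {} \<and> K \<subseteq> U) \<and>
     (\<Union>(c, K)\<in>\<K>. K) = UNIV"

definition chart_Cr_norm ::
  "(('m, 'n::finite) chart \<times> 'm set) set \<Rightarrow> nat \<Rightarrow> ('m \<Rightarrow> 'b::real_normed_vector) \<Rightarrow> real" where
  "chart_Cr_norm \<K> r f =
     (\<Sum>((U, x), K)\<in>\<K>. \<Sum>js\<in>{js. length js \<le> r}.
        SUP z\<in>x ` K. norm (iter_partial js (f \<circ> inv_into U x) z))"

definition Cr_norm ::
  "('m::{t2_space, second_countable_topology}, 'n::finite) chart set \<Rightarrow> nat \<Rightarrow>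
   (('m \<Rightarrow> complex) \<Rightarrow> real) \<Rightarrow> bool" where
  "Cr_norm \<A> r N \<longleftrightarrow>
     (\<forall>f\<in>Cr_funs \<A> r. \<forall>g\<in>Cr_funs \<A> r. N (\<lambda>x. f x + g x) \<le> N f + N g) \<and>
     (\<forall>f\<in>Cr_funs \<A> r. \<forall>a. N (\<lambda>x. a * f x) = norm a * N f) \<and>
     (\<exists>\<K> c c'. chart_cover \<A> \<K> \<and> c > 0 \<and>
        (\<forall>f\<in>Cr_funs \<A> r. c * chart_Cr_norm \<K> r f \<le> N f \<and> N f \<le> c' * chart_Cr_norm \<K> r f))"


section \<open>The two kinds of Banach spaces\<close>

text \<open>
  The weak space is an abstract Banach space \<open>'w\<close> whose elements are identified with
  functions, resp. distributions, on the manifold through an injective linear map. Real scalars and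
  complex values cover both real and complex Banach spaces: a complex Banach space is used
  through its underlying real one.
\<close>

definition function_realization ::
  "'m::topological_space measure \<Rightarrow> ('w::banach \<Rightarrow> 'm \<Rightarrow> complex) \<Rightarrow> bool" where
  "function_realization m fn \<longleftrightarrow>
     inj fn \<and>
     (\<forall>h k x. fn (h + k) x = fn h x + fn k x) \<and>
     (\<forall>a h x. fn (a *\<^sub>R h) x = a *\<^sub>R fn h x) \<and>
     (\<forall>h. fn h \<in> borel_measurable m \<and> bounded (range (fn h)) \<and>
          (SUP x. norm (fn h x)) \<le> norm h)"

definition distribution_realization ::
  "('m::{t2_space, second_countable_topology}, 'n::finite) chart set \<Rightarrow> nat \<Rightarrow>
   (('m \<Rightarrow> complex) \<Rightarrow> real) \<Rightarrow> ('w::banach \<Rightarrow> ('m \<Rightarrow> complex) \<Rightarrow> complex) \<Rightarrow> bool" where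
  "distribution_realization \<A> r N pair \<longleftrightarrow>
     (\<forall>h k. (\<forall>f\<in>Cr_funs \<A> r. pair h f = pair k f) \<longrightarrow> h = k) \<and>
     (\<forall>h k. \<forall>f\<in>Cr_funs \<A> r. pair (h + k) f = pair h f + pair k f) \<and>
     (\<forall>a h. \<forall>f\<in>Cr_funs \<A> r. pair (a *\<^sub>R h) f = a *\<^sub>R pair h f) \<and>
     (\<forall>h. \<forall>f\<in>Cr_funs \<A> r. \<forall>g\<in>Cr_funs \<A> r. pair h (\<lambda>x. f x + g x) = pair h f + pair h g) \<and>
     (\<forall>h a. \<forall>f\<in>Cr_funs \<A> r. pair h (\<lambda>x. a * f x) = a * pair h f) \<and>
     (\<exists>C>0. \<forall>h. \<forall>f\<in>Cr_funs \<A> r. norm (pair h f) \<le> C * norm h * N f)"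

definition probability_density :: "'m measure \<Rightarrow> ('m \<Rightarrow> complex) \<Rightarrow> bool" where
  "probability_density m f \<longleftrightarrow>
     (AE x in m. f x \<in> \<real> \<and> 0 \<le> Re (f x)) \<and> integrable m f \<and> (\<integral>x. f x \<partial>m) = 1"


section \<open>Cocycles and semi-normed spaces of observables on the base\<close>

primrec cocycle :: "('a \<Rightarrow> 'a) \<Rightarrow> ('a \<Rightarrow> 'w \<Rightarrow> 'w) \<Rightarrow> nat \<Rightarrow> 'a \<Rightarrow> 'w \<Rightarrow> 'w" where
  "cocycle s L 0 \<omega> = id"
| "cocycle s L (Suc n) \<omega> = L ((s ^^ n) \<omega>) \<circ> cocycle s L n \<omega>"

definition seminormed_observables ::
  "('a::topological_space \<Rightarrow> real) set \<Rightarrow> (('a \<Rightarrow> real) \<Rightarrow> real) \<Rightarrow> bool" where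
  "seminormed_observables F N \<longleftrightarrow>
     (\<forall>f\<in>F. f \<in> borel_measurable borel \<and> bounded (range f)) \<and>
     (\<lambda>_. 0) \<in> F \<and>
     (\<forall>f\<in>F. \<forall>g\<in>F. (\<lambda>\<omega>. f \<omega> + g \<omega>) \<in> F \<and> N (\<lambda>\<omega>. f \<omega> + g \<omega>) \<le> N f + N g) \<and>
     (\<forall>f\<in>F. \<forall>a. (\<lambda>\<omega>. a * f \<omega>) \<in> F \<and> N (\<lambda>\<omega>. a * f \<omega>) = \<bar>a\<bar> * N f) \<and>
     (\<forall>f\<in>F. 0 \<le> N f)"

text \<open>
  The dual semi-norm of the signed measure \<open>\<mu> - \<nu>\<close>, with its integral written as a
  difference of two integrals.
\<close>

definition dual_seminorm_diff ::
  "('a \<Rightarrow> real) set \<Rightarrow> (('a \<Rightarrow> real) \<Rightarrow> real) \<Rightarrow> 'a measure \<Rightarrow> 'a measure \<Rightarrow> real" where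
  "dual_seminorm_diff F N \<mu> \<nu> =
     (SUP f\<in>{f \<in> F. N f \<le> 1}. \<bar>(\<integral>\<omega>. f \<omega> \<partial>\<mu>) - (\<integral>\<omega>. f \<omega> \<partial>\<nu>)\<bar>)"

definition dist_C0 :: "('a \<Rightarrow> 'b::metric_space) \<Rightarrow> ('a \<Rightarrow> 'b) \<Rightarrow> real" where
  "dist_C0 f g = (SUP y. dist (f y) (g y))"

end

theory Submission
  imports Defs
begin

text \<open>
  Both \<open>h \<omega> \<epsilon>\<close> and \<open>h \<omega> 0\<close> are images of earlier members of their families along the backward
  orbits of \<open>\<omega>\<close> under \<open>\<sigma> \<epsilon>\<close> and \<open>\<sigma> 0\<close>. Telescoping over \<open>n\<close> steps writes their difference as an
  \<open>n\<close>-step image of a difference in \<open>ker \<psi>\<close>, which is exponentially small, plus \<open>n\<close> one-step errors,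
  also in \<open>ker \<psi>\<close>, which tend to 0 for fixed \<open>n\<close> because the two backward orbits stay close.
  Hence \<open>h \<omega> \<epsilon>\<close> tends to \<open>h \<omega> 0\<close> in the weak norm uniformly in \<open>\<omega>\<close>, and the fibre integrals of \<open>\<Phi>\<close> are
  uniformly close to \<open>\<phi>\<close>, with an error controlled by the bounded function \<open>\<theta>\<close>. What remains is the
  convergence of the integrals of \<open>\<phi>\<close> itself, which is the dual semi-norm convergence.
\<close>

section \<open>Uniform weak stability of equivariant families\<close>

text \<open>\<open>cocycle\<close> grows by a factor on the left, at the end of the orbit. Going one
  step further back along a backward orbit adds a factor at its start instead, which is the form the
  telescoping needs.\<close>

lemma cocycle_Suc_right: "cocycle s L (Suc n) \<omega> = cocycle s L n (s \<omega>) \<circ> L \<omega>"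
  by (induction n) (simp_all add: funpow_swap1 fun_eq_iff)

lemma linear_cocycle:
  assumes "\<And>\<omega>. linear (L \<omega>)"
  shows "linear (cocycle s L n \<omega>)"
proof (induction n)
  case 0
  then show ?case by (simp add: linear_id id_def module_hom_ident)
next
  case (Suc n)
  then show ?case using assms by (simp only: cocycle.simps linear_compose)
qed

text \<open>Each gap \<open>u n - v n\<close> is a one-step error plus \<open>L\<close> applied to
  the next gap, and that second term is absorbed into a cocycle longer by one factor. The error
  compares \<open>L'\<close> and \<open>L\<close> at the same vector \<open>u (Suc k)\<close>; only
  \<open>L\<close> is iterated, so only its decay will be used.\<close>

lemma cocycle_telescope:
  assumes "\<And>\<omega>. linear (L \<omega>)"
    and "\<And>k. s (b (Suc k)) = b k"
    and "\<And>k. L' k (u (Suc k)) = u k"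
    and "\<And>k. L (b (Suc k)) (v (Suc k)) = v k"
  shows "u 0 - v 0 = cocycle s L n (b n) (u n - v n)
           + (\<Sum>k<n. cocycle s L k (b k) (L' k (u (Suc k)) - L (b (Suc k)) (u (Suc k))))"
proof (induction n)
  case 0
  then show ?case by simp
next
  case (Suc n)
  let ?d = "L' n (u (Suc n)) - L (b (Suc n)) (u (Suc n))"
  have "u n - v n = ?d + L (b (Suc n)) (u (Suc n) - v (Suc n))"
    by (simp add: assms(3,4) linear_diff[OF assms(1)])
  then have "cocycle s L n (b n) (u n - v n)
      = cocycle s L n (b n) ?d + cocycle s L n (b n) (L (b (Suc n)) (u (Suc n) - v (Suc n)))"
    by (simp only: linear_add[OF linear_cocycle[OF assms(1)]])
  also have "cocycle s L n (b n) (L (b (Suc n)) (u (Suc n) - v (Suc n)))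
      = cocycle s L (Suc n) (b (Suc n)) (u (Suc n) - v (Suc n))"
    by (simp only: cocycle_Suc_right assms(2) o_apply)
  finally show ?case using Suc.IH by (simp add: algebra_simps del: cocycle.simps)
qed

text \<open>One step multiplies the old gap by at most \<open>K\<close>, by the Lipschitz bound of
  \<open>f\<close>, and adds at most \<open>\<delta>\<close>, the distance of \<open>f\<close> and
  \<open>f'\<close> at the same point. Growth in \<open>k\<close> is harmless: later only finitely
  many \<open>k\<close> occur while \<open>\<delta>\<close> tends to 0.\<close>

lemma dist_inverse_orbits_le:
  fixes f f' :: "'a::metric_space \<Rightarrow> 'a"
  assumes "K-lipschitz_on UNIV f"
    and "\<And>y. dist (f y) (f' y) \<le> \<delta>"
  shows "dist ((f' ^^ k) \<omega>) ((f ^^ k) \<omega>) \<le> \<delta> * (\<Sum>j<k. K ^ j)"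
proof (induction k)
  case 0
  then show ?case by simp
next
  case (Suc k)
  have "dist (f' ((f' ^^ k) \<omega>)) (f ((f ^^ k) \<omega>))
      \<le> dist (f' ((f' ^^ k) \<omega>)) (f ((f' ^^ k) \<omega>)) + dist (f ((f' ^^ k) \<omega>)) (f ((f ^^ k) \<omega>))"
    by (rule dist_triangle)
  also have "\<dots> \<le> \<delta> + K * dist ((f' ^^ k) \<omega>) ((f ^^ k) \<omega>)"
    by (intro add_mono lipschitz_onD[OF assms(1)]) (use assms(2) in \<open>auto simp: dist_commute\<close>)
  also have "\<dots> \<le> \<delta> + K * (\<delta> * (\<Sum>j<k. K ^ j))"
    by (intro add_left_mono mult_left_mono Suc.IH lipschitz_on_nonneg[OF assms(1)])
  also have "\<dots> = \<delta> * (\<Sum>j<Suc k. K ^ j)"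
    by (simp only: sum.lessThan_Suc_shift) (simp add: sum_distrib_left algebra_simps)
  finally show ?case by simp
qed

text \<open>Boundedness of the target space bounds the set of distances from above, so that the real
  \<open>SUP\<close> in \<open>dist_C0\<close> is a genuine supremum.\<close>

lemma dist_le_dist_C0:
  assumes "bounded (UNIV :: 'b::metric_space set)"
  shows "dist (f y) (g y :: 'b) \<le> dist_C0 f g"
proof -
  obtain c where c: "\<And>x y :: 'b. dist x y \<le> c"
    using assms unfolding bounded_two_points by auto
  show ?thesis
    unfolding dist_C0_def by (rule cSUP_upper) (auto intro!: bdd_aboveI[of _ c] c)
qed

text \<open>The decay applies because the last gap and all one-step errors lie in the kernel of
  \<open>\<psi>\<close>: the families share the value \<open>a\<close>, and the operators preserve
  \<open>\<psi>\<close>. In \<open>reg\<close> the factor \<open>C\<close> stands for the bound on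
  the strong norm of \<open>u\<close>, so the argument needs one normed space. On
  \<open>\<Omega> \<epsilon> \<inter> \<Omega> 0\<close> both backward orbits of a point stay in
  their invariant sets.\<close>

lemma equivariant_families_close:
  fixes L :: "real \<Rightarrow> 'a::metric_space \<Rightarrow> 'w::real_normed_vector \<Rightarrow> 'w"
    and u :: "real \<Rightarrow> 'a \<Rightarrow> 'w"
    and \<psi> :: "'w \<Rightarrow> 'b::real_normed_vector"
  assumes bdd: "bounded (UNIV :: 'a set)"
    and zero: "0 \<in> I"
    and bij: "\<And>\<epsilon>. \<epsilon> \<in> I \<Longrightarrow> bij (\<sigma> \<epsilon>)"
    and psi: "linear \<psi>"
    and lin: "\<And>\<omega>. linear (L 0 \<omega>)"
    and psiL: "\<And>\<epsilon> \<omega> x. \<epsilon> \<in> I \<Longrightarrow> \<psi> (L \<epsilon> \<omega> x) = \<psi> x"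
    and "C > 0" "lam > 0" "\<zeta> > 0"
    and inv: "\<And>\<epsilon>. \<epsilon> \<in> I \<Longrightarrow> \<sigma> \<epsilon> ` \<Omega> \<epsilon> = \<Omega> \<epsilon>"
    and decay: "\<And>x n \<omega>. \<psi> x = 0 \<Longrightarrow> n \<ge> 1 \<Longrightarrow> \<omega> \<in> \<Omega> 0 \<Longrightarrow>
           norm (cocycle (\<sigma> 0) (L 0) n \<omega> x) \<le> C * exp (- lam * real n) * norm x"
    and reg: "\<And>\<epsilon> \<omega> \<omega>'. \<epsilon> \<in> I \<Longrightarrow> \<omega> \<in> \<Omega> \<epsilon> \<Longrightarrow> \<omega>' \<in> \<Omega> 0 \<Longrightarrow>
           norm (L \<epsilon> \<omega> (u \<epsilon> \<omega>) - L 0 \<omega>' (u \<epsilon> \<omega>))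
             \<le> C * (dist \<omega> \<omega>' powr \<zeta> + \<bar>\<epsilon>\<bar> powr \<zeta>) * C"
    and u1: "\<And>\<epsilon> \<omega>. \<epsilon> \<in> I \<Longrightarrow> \<omega> \<in> \<Omega> \<epsilon> \<Longrightarrow> \<psi> (u \<epsilon> \<omega>) = a \<and> norm (u \<epsilon> \<omega>) \<le> C"
    and equi: "\<And>\<epsilon> \<omega>. \<epsilon> \<in> I \<Longrightarrow> \<omega> \<in> \<Omega> \<epsilon> \<Longrightarrow> L \<epsilon> \<omega> (u \<epsilon> \<omega>) = u \<epsilon> (\<sigma> \<epsilon> \<omega>)"
    and lip: "K-lipschitz_on UNIV (inv (\<sigma> 0))"
    and lim: "((\<lambda>\<epsilon>. dist_C0 (inv (\<sigma> 0)) (inv (\<sigma> \<epsilon>))) \<longlongrightarrow> 0) (at 0 within I)"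
    and "e > 0"
  shows "\<forall>\<^sub>F \<epsilon> in at 0 within I. \<forall>\<omega>\<in>\<Omega> \<epsilon> \<inter> \<Omega> 0. norm (u \<epsilon> \<omega> - u 0 \<omega>) < e"
proof -
  define \<delta> where "\<delta> \<epsilon> = dist_C0 (inv (\<sigma> 0)) (inv (\<sigma> \<epsilon>))" for \<epsilon>
  define T where "T k = (\<Sum>j<k. K ^ j)" for k :: nat
  \<comment> \<open>\<open>2 * C\<close> bounds the gap of the two families. \<open>1 + C\<close>
    bounds the cocycle on the errors, both for \<open>k = 0\<close>, where it is the identity and
    \<open>decay\<close> is silent, and for positive \<open>k\<close>. \<open>T (Suc k)\<close>
    enters because error number \<open>k\<close> compares the orbits at time
    \<open>Suc k\<close>.\<close>
  define D where "D n \<epsilon> = C * exp (- lam * real n) * (2 * C)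
      + (\<Sum>k<n. (1 + C) * (C * ((\<delta> \<epsilon> * T (Suc k)) powr \<zeta> + \<bar>\<epsilon>\<bar> powr \<zeta>) * C))" for n \<epsilon>
  have delta: "dist (inv (\<sigma> 0) y) (inv (\<sigma> \<epsilon>) y) \<le> \<delta> \<epsilon>" for y \<epsilon>
    unfolding \<delta>_def by (rule dist_le_dist_C0[OF bdd])
  have delta0: "0 \<le> \<delta> \<epsilon>" for \<epsilon>
    using delta zero_le_dist order_trans by blast
  have T0: "0 \<le> T k" for k
    unfolding T_def by (intro sum_nonneg zero_le_power lipschitz_on_nonneg[OF lip])
  have bound: "norm (u \<epsilon> \<omega> - u 0 \<omega>) \<le> D n \<epsilon>"
    if \<epsilon>: "\<epsilon> \<in> I" and \<omega>: "\<omega> \<in> \<Omega> \<epsilon>" "\<omega> \<in> \<Omega> 0" and n: "n \<ge> 1" for \<epsilon> \<omega> n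
  proof -
    \<comment> \<open>Inside this block \<open>a\<close> is the backward orbit under
      \<open>\<sigma> \<epsilon>\<close> and hides the common value of
      \<open>\<psi>\<close>.\<close>
    define a where "a k = (inv (\<sigma> \<epsilon>) ^^ k) \<omega>" for k
    define b where "b k = (inv (\<sigma> 0) ^^ k) \<omega>" for k
    have inv_in: "inv (\<sigma> \<epsilon>) y \<in> \<Omega> \<epsilon>" if "y \<in> \<Omega> \<epsilon>" "\<epsilon> \<in> I" for y \<epsilon>
      using inv[OF that(2)] bij[OF that(2)] that(1)
      by (metis bij_is_inj imageE inv_f_f)
    have a: "a k \<in> \<Omega> \<epsilon>" for k
      unfolding a_def using \<epsilon> \<omega>(1) by (induction k) (auto intro: inv_in)
    have b: "b k \<in> \<Omega> 0" for k
      unfolding b_def using zero \<omega>(2) by (induction k) (auto intro: inv_in)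
    have sa: "\<sigma> \<epsilon> (a (Suc k)) = a k" for k
      unfolding a_def using bij[OF \<epsilon>] by (simp add: bij_is_surj surj_f_inv_f)
    have sb: "\<sigma> 0 (b (Suc k)) = b k" for k
      unfolding b_def using bij[OF zero] by (simp add: bij_is_surj surj_f_inv_f)
    define w where "w k = L \<epsilon> (a (Suc k)) (u \<epsilon> (a (Suc k))) - L 0 (b (Suc k)) (u \<epsilon> (a (Suc k)))" for k
    have psi_w: "\<psi> (w k) = 0" for k
      unfolding w_def using \<epsilon> zero by (simp add: linear_diff[OF psi] psiL)
    have norm_w: "norm (w k) \<le> C * ((\<delta> \<epsilon> * T (Suc k)) powr \<zeta> + \<bar>\<epsilon>\<bar> powr \<zeta>) * C" for k
    proof -
      have "dist (a (Suc k)) (b (Suc k)) \<le> \<delta> \<epsilon> * T (Suc k)"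
        unfolding a_def b_def T_def by (rule dist_inverse_orbits_le[OF lip delta])
      then have "dist (a (Suc k)) (b (Suc k)) powr \<zeta> \<le> (\<delta> \<epsilon> * T (Suc k)) powr \<zeta>"
        using \<open>\<zeta> > 0\<close> by (intro powr_mono2) auto
      then have "C * (dist (a (Suc k)) (b (Suc k)) powr \<zeta> + \<bar>\<epsilon>\<bar> powr \<zeta>) * C
          \<le> C * ((\<delta> \<epsilon> * T (Suc k)) powr \<zeta> + \<bar>\<epsilon>\<bar> powr \<zeta>) * C"
        using \<open>C > 0\<close> by (intro mult_right_mono mult_left_mono) auto
      then show ?thesis unfolding w_def using reg[OF \<epsilon> a b] by (meson order_trans)
    qed
    have coc: "norm (cocycle (\<sigma> 0) (L 0) k (b k) (w k)) \<le> (1 + C) * norm (w k)" for k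
    proof (cases "k = 0")
      case True
      then show ?thesis using \<open>C > 0\<close> by (simp add: algebra_simps)
    next
      case False
      then have "norm (cocycle (\<sigma> 0) (L 0) k (b k) (w k)) \<le> C * exp (- lam * real k) * norm (w k)"
        by (intro decay psi_w b) simp
      also have "\<dots> \<le> (1 + C) * norm (w k)"
      proof (rule mult_right_mono)
        have "C * exp (- lam * real k) \<le> C * 1"
          using \<open>C > 0\<close> \<open>lam > 0\<close> by (intro mult_left_mono) auto
        then show "C * exp (- lam * real k) \<le> 1 + C" by simp
      qed simp
      finally show ?thesis .
    qed
    \<comment> \<open>At time 0 both backward orbits are at \<open>\<omega>\<close>, so the
      left-hand side of the telescoping identity is the difference to be bounded.\<close>
    have "u \<epsilon> \<omega> - u 0 \<omega> = cocycle (\<sigma> 0) (L 0) n (b n) (u \<epsilon> (a n) - u 0 (b n))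
        + (\<Sum>k<n. cocycle (\<sigma> 0) (L 0) k (b k) (w k))"
      using cocycle_telescope[of "L 0" "\<sigma> 0" b "\<lambda>k. L \<epsilon> (a (Suc k))" "\<lambda>k. u \<epsilon> (a k)" "\<lambda>k. u 0 (b k)" n]
      by (simp add: lin sb sa equi[OF \<epsilon> a] equi[OF zero b] w_def) (simp add: a_def b_def)
    also have "norm \<dots> \<le> norm (cocycle (\<sigma> 0) (L 0) n (b n) (u \<epsilon> (a n) - u 0 (b n)))
        + (\<Sum>k<n. norm (cocycle (\<sigma> 0) (L 0) k (b k) (w k)))"
      by (intro norm_triangle_mono order_refl norm_sum)
    also have "\<dots> \<le> D n \<epsilon>"
      unfolding D_def
    proof (intro add_mono sum_mono)
      have "norm (u \<epsilon> (a n) - u 0 (b n)) \<le> 2 * C"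
        using u1[OF \<epsilon> a[of n]] u1[OF zero b[of n]] norm_triangle_ineq4[of "u \<epsilon> (a n)" "u 0 (b n)"]
        by linarith
      then show "norm (cocycle (\<sigma> 0) (L 0) n (b n) (u \<epsilon> (a n) - u 0 (b n)))
          \<le> C * exp (- lam * real n) * (2 * C)"
        using u1[OF \<epsilon> a[of n]] u1[OF zero b[of n]] \<open>C > 0\<close>
        by (intro order_trans[OF decay[OF _ n b]] mult_left_mono)
           (auto simp: linear_diff[OF psi])
    next
      fix k
      show "norm (cocycle (\<sigma> 0) (L 0) k (b k) (w k))
          \<le> (1 + C) * (C * ((\<delta> \<epsilon> * T (Suc k)) powr \<zeta> + \<bar>\<epsilon>\<bar> powr \<zeta>) * C)"
        using \<open>C > 0\<close> by (intro order_trans[OF coc] mult_left_mono norm_w) auto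
    qed
    finally show ?thesis .
  qed
  \<comment> \<open>The length \<open>n\<close> is fixed first, so that the exponential term drops
    below \<open>e\<close>; afterwards the finite error sum tends to 0 with
    \<open>\<epsilon>\<close>.\<close>
  have "(\<lambda>n. C * exp (- lam * real n) * (2 * C)) \<longlonglongrightarrow> C * 0 * (2 * C)"
  proof (intro tendsto_intros)
    have "filterlim (\<lambda>n. lam * real n) at_top sequentially"
      by (rule filterlim_tendsto_pos_mult_at_top[OF tendsto_const \<open>lam > 0\<close> filterlim_real_sequentially])
    then show "(\<lambda>n. exp (- lam * real n)) \<longlonglongrightarrow> 0"
      by (intro filterlim_compose[OF exp_at_bot]) (simp add: filterlim_uminus_at_bot)
  qed
  then have "\<forall>\<^sub>F n in sequentially. C * exp (- lam * real n) * (2 * C) < e \<and> n \<ge> 1"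
    by (intro eventually_conj order_tendstoD(2)[where y = 0] eventually_ge_at_top) (use \<open>e > 0\<close> in auto)
  then obtain n where n: "C * exp (- lam * real n) * (2 * C) < e" "n \<ge> 1"
    by (auto simp: eventually_sequentially)
  have "((\<lambda>\<epsilon>. D n \<epsilon>) \<longlongrightarrow> C * exp (- lam * real n) * (2 * C)
      + (\<Sum>k<n. (1 + C) * (C * (0 + 0) * C))) (at 0 within I)"
    unfolding D_def
  proof (intro tendsto_add tendsto_sum tendsto_mult tendsto_const)
    fix k
    have "((\<lambda>\<epsilon>. \<delta> \<epsilon> * T (Suc k)) \<longlongrightarrow> 0 * T (Suc k)) (at 0 within I)"
      using lim unfolding \<delta>_def by (intro tendsto_intros)
    then show "((\<lambda>\<epsilon>. (\<delta> \<epsilon> * T (Suc k)) powr \<zeta>) \<longlongrightarrow> 0) (at 0 within I)"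
      using \<open>\<zeta> > 0\<close> delta0 T0 by (intro tendsto_zero_powrI[OF _ tendsto_const]) auto
    have "((\<lambda>\<epsilon>::real. \<bar>\<epsilon>\<bar>) \<longlongrightarrow> 0) (at 0 within I)"
      by (intro tendsto_rabs_zero tendsto_ident_at)
    then show "((\<lambda>\<epsilon>::real. \<bar>\<epsilon>\<bar> powr \<zeta>) \<longlongrightarrow> 0) (at 0 within I)"
      using \<open>\<zeta> > 0\<close> by (intro tendsto_zero_powrI[OF _ tendsto_const]) auto
  qed
  then have "\<forall>\<^sub>F \<epsilon> in at 0 within I. D n \<epsilon> < e"
    using n(1) by (intro order_tendstoD(2)) auto
  moreover have "\<forall>\<^sub>F \<epsilon> in at 0 within I. \<epsilon> \<in> I"
    by (simp add: eventually_at_filter)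
  ultimately show ?thesis
    by eventually_elim (use bound n(2) in \<open>fastforce intro: le_less_trans\<close>)
qed

section \<open>Disintegration of the product measures\<close>

text \<open>The kernel is controlled on \<open>S\<close> alone, so the base is
  \<open>restrict_space M S\<close>. Pushing \<open>\<kappa> \<omega>\<close> forward along
  \<open>Pair \<omega>\<close> and averaging over the base gives a measure that has the fibre
  formula by construction; \<open>\<mu>\<close> equals it because the two agree on
  rectangles.\<close>

lemma nn_integral_disintegration:
  fixes f :: "'a \<times> 'b \<Rightarrow> ennreal"
  assumes \<kappa>: "\<kappa> \<in> measurable (restrict_space M S) (prob_algebra N)"
    and S: "S \<in> sets M" "S \<noteq> {}"
    and fin: "finite_measure M"
    and sets_\<mu>: "sets \<mu> = sets (M \<Otimes>\<^sub>M N)"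
    and rect: "\<And>A B. A \<in> sets M \<Longrightarrow> B \<in> sets N \<Longrightarrow>
           emeasure \<mu> (A \<times> B) = (\<integral>\<^sup>+\<omega>\<in>A \<inter> S. emeasure (\<kappa> \<omega>) B \<partial>M)"
    and f: "f \<in> borel_measurable (M \<Otimes>\<^sub>M N)"
  shows "(\<integral>\<^sup>+z. f z \<partial>\<mu>) = (\<integral>\<^sup>+\<omega>. (\<integral>\<^sup>+x. f (\<omega>, x) \<partial>\<kappa> \<omega>) \<partial>restrict_space M S)"
proof -
  let ?R = "restrict_space M S"
  have S_space: "S \<inter> space M = S" "S \<inter> space M \<in> sets M"
    using S(1) sets.sets_into_space by (auto simp: Int_absorb2)
  have space_R: "space ?R = S" using S_space by (simp add: space_restrict_space)
  note \<kappa>' = measurable_prob_algebraD[OF \<kappa>]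
  have \<kappa>_S: "sets (\<kappa> \<omega>) = sets N" "prob_space (\<kappa> \<omega>)" if "\<omega> \<in> S" for \<omega>
    using measurable_space[OF \<kappa>, of \<omega>] that by (auto simp: space_R space_prob_algebra)
  have id: "(\<lambda>\<omega>. \<omega>) \<in> measurable ?R M" by (rule measurable_restrict_space1) simp
  have k: "(\<lambda>\<omega>. distr (\<kappa> \<omega>) (M \<Otimes>\<^sub>M N) (Pair \<omega>)) \<in> measurable ?R (subprob_algebra (M \<Otimes>\<^sub>M N))"
  proof (rule measurable_distr2[OF _ \<kappa>'])
    \<comment> \<open>This map is the identity, read as a measurable map from the product over the
      restricted base into the full product.\<close>
    have "(\<lambda>z. (fst z, snd z)) \<in> measurable (?R \<Otimes>\<^sub>M N) (M \<Otimes>\<^sub>M N)"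
      by (intro measurable_Pair measurable_snd measurable_compose[OF measurable_fst id])
    then show "case_prod Pair \<in> measurable (?R \<Otimes>\<^sub>M N) (M \<Otimes>\<^sub>M N)"
      by (simp add: id_def)
  qed
  define \<nu> where "\<nu> = ?R \<bind> (\<lambda>\<omega>. distr (\<kappa> \<omega>) (M \<Otimes>\<^sub>M N) (Pair \<omega>))"
  have nn_\<nu>: "(\<integral>\<^sup>+z. f z \<partial>\<nu>) = (\<integral>\<^sup>+\<omega>. (\<integral>\<^sup>+x. f (\<omega>, x) \<partial>\<kappa> \<omega>) \<partial>?R)"
    if f: "f \<in> borel_measurable (M \<Otimes>\<^sub>M N)" for f :: "'a \<times> 'b \<Rightarrow> ennreal"
    unfolding \<nu>_def nn_integral_bind[OF f k]
  proof (intro nn_integral_cong nn_integral_distr)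
    fix \<omega> assume "\<omega> \<in> space ?R"
    then have "\<omega> \<in> space M" "\<omega> \<in> S"
      using sets.sets_into_space[OF S(1)] by (auto simp: space_R)
    then show "Pair \<omega> \<in> measurable (\<kappa> \<omega>) (M \<Otimes>\<^sub>M N)"
      using measurable_Pair1'[of \<omega> M N] measurable_cong_sets[OF \<kappa>_S(1) refl] by blast
  qed (simp add: f)
  \<comment> \<open>\<open>S \<noteq> {}\<close> matters here: over an empty space
    \<open>bind\<close> is a default measure, whose sigma-algebra need not be that of the
    product.\<close>
  have sets_\<nu>: "sets \<nu> = sets (M \<Otimes>\<^sub>M N)"
    unfolding \<nu>_def by (rule sets_bind) (use S in \<open>auto simp: space_R\<close>)
  have rect_\<nu>: "emeasure \<nu> (A \<times> B) = (\<integral>\<^sup>+\<omega>\<in>A \<inter> S. emeasure (\<kappa> \<omega>) B \<partial>M)"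
    if AB: "A \<in> sets M" "B \<in> sets N" for A B
  proof -
    have "emeasure \<nu> (A \<times> B) = (\<integral>\<^sup>+z. indicator (A \<times> B) z \<partial>\<nu>)"
      using AB sets_\<nu> by (simp add: nn_integral_indicator)
    also have "\<dots> = (\<integral>\<^sup>+\<omega>. (\<integral>\<^sup>+x. indicator (A \<times> B) (\<omega>, x) \<partial>\<kappa> \<omega>) \<partial>?R)"
      using AB by (intro nn_\<nu>) auto
    also have "\<dots> = (\<integral>\<^sup>+\<omega>. (\<integral>\<^sup>+x. indicator A \<omega> * indicator B x \<partial>\<kappa> \<omega>) \<partial>?R)"
      by (simp add: indicator_times)
    also have "\<dots> = (\<integral>\<^sup>+\<omega>. indicator A \<omega> * emeasure (\<kappa> \<omega>) B \<partial>?R)"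
      using AB \<kappa>_S by (intro nn_integral_cong) (simp add: space_R nn_integral_cmult_indicator)
    also have "\<dots> = (\<integral>\<^sup>+\<omega>. indicator A \<omega> * emeasure (\<kappa> \<omega>) B * indicator S \<omega> \<partial>M)"
      by (rule nn_integral_restrict_space[OF S_space(2)])
    also have "\<dots> = (\<integral>\<^sup>+\<omega>\<in>A \<inter> S. emeasure (\<kappa> \<omega>) B \<partial>M)"
      by (intro nn_integral_cong) (auto simp: indicator_def)
    finally show ?thesis .
  qed
  \<comment> \<open>Rectangles are stable under intersection and generate the product sigma-algebra.
    The constant sequence \<open>space M \<times> space N\<close> serves as the exhaustion, its mass
    being at most that of \<open>M\<close>.\<close>
  have "\<mu> = \<nu>"
  proof (rule measure_eqI_generator_eq[OF Int_stable_pair_measure_generator pair_measure_closed])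
    show "sets \<mu> = sigma_sets (space M \<times> space N) {a \<times> b | a b. a \<in> sets M \<and> b \<in> sets N}"
      "sets \<nu> = sigma_sets (space M \<times> space N) {a \<times> b | a b. a \<in> sets M \<and> b \<in> sets N}"
      by (simp_all add: sets_\<mu> sets_\<nu> sets_pair_measure)
    show "emeasure \<mu> X = emeasure \<nu> X" if "X \<in> {a \<times> b | a b. a \<in> sets M \<and> b \<in> sets N}" for X
      using that rect rect_\<nu> by auto
    show "range (\<lambda>_::nat. space M \<times> space N) \<subseteq> {a \<times> b | a b. a \<in> sets M \<and> b \<in> sets N}"
      by blast
    have "emeasure \<mu> (space M \<times> space N) = (\<integral>\<^sup>+\<omega>\<in>space M \<inter> S. emeasure (\<kappa> \<omega>) (space N) \<partial>M)"
      by (rule rect) auto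
    also have "\<dots> \<le> (\<integral>\<^sup>+\<omega>. 1 \<partial>M)"
      by (intro nn_integral_mono) (auto simp: indicator_def intro!: prob_space.emeasure_le_1 \<kappa>_S)
    also have "\<dots> < \<infinity>" using finite_measure.finite_emeasure_space[OF fin] by (simp add: less_top)
    finally show "emeasure \<mu> (space M \<times> space N) \<noteq> \<infinity>" for i :: nat by simp
  qed simp
  then show ?thesis using nn_\<nu>[OF f] by simp
qed

text \<open>The uniform bound \<open>B\<close> makes the fibre integrals integrable over the finite
  base. All values being finite, the formula for nonnegative integrals turns into one for Bochner
  integrals.\<close>

lemma integral_disintegration_nonneg:
  fixes f :: "'a \<times> 'b \<Rightarrow> real"
  assumes \<kappa>: "\<kappa> \<in> measurable (restrict_space M S) (prob_algebra N)"
    and S: "S \<in> sets M" "S \<noteq> {}"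
    and fin: "finite_measure M"
    and sets_\<mu>: "sets \<mu> = sets (M \<Otimes>\<^sub>M N)"
    and rect: "\<And>A B. A \<in> sets M \<Longrightarrow> B \<in> sets N \<Longrightarrow>
           emeasure \<mu> (A \<times> B) = (\<integral>\<^sup>+\<omega>\<in>A \<inter> S. emeasure (\<kappa> \<omega>) B \<partial>M)"
    and f: "f \<in> borel_measurable (M \<Otimes>\<^sub>M N)" "\<And>z. 0 \<le> f z"
    and int: "\<And>\<omega>. \<omega> \<in> S \<Longrightarrow> integrable (\<kappa> \<omega>) (\<lambda>x. f (\<omega>, x))"
    and bound: "\<And>\<omega>. \<omega> \<in> S \<Longrightarrow> (\<integral>x. f (\<omega>, x) \<partial>\<kappa> \<omega>) \<le> B"
  shows "integrable \<mu> f"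
    and "integrable (restrict_space M S) (\<lambda>\<omega>. \<integral>x. f (\<omega>, x) \<partial>\<kappa> \<omega>)"
    and "(\<integral>z. f z \<partial>\<mu>) = (\<integral>\<omega>. (\<integral>x. f (\<omega>, x) \<partial>\<kappa> \<omega>) \<partial>restrict_space M S)"
proof -
  let ?R = "restrict_space M S"
  have S_space: "S \<inter> space M = S" "S \<inter> space M \<in> sets M"
    using S(1) sets.sets_into_space by (auto simp: Int_absorb2)
  have space_R: "space ?R = S" using S_space by (simp add: space_restrict_space)
  interpret R: finite_measure ?R
    by (intro finite_measure_restrict_space fin) (simp add: S_space S(1))
  have id: "(\<lambda>\<omega>. \<omega>) \<in> measurable ?R M" by (rule measurable_restrict_space1) simp
  have f': "(\<lambda>(\<omega>, x). ennreal (f (\<omega>, x))) \<in> borel_measurable (?R \<Otimes>\<^sub>M N)"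
  proof -
    have "(\<lambda>z. (fst z, snd z)) \<in> measurable (?R \<Otimes>\<^sub>M N) (M \<Otimes>\<^sub>M N)"
      by (intro measurable_Pair measurable_snd measurable_compose[OF measurable_fst id])
    from measurable_compose[OF this f(1)] show ?thesis by (simp add: case_prod_beta')
  qed
  have eq: "(\<integral>\<^sup>+x. ennreal (f (\<omega>, x)) \<partial>\<kappa> \<omega>) = ennreal (\<integral>x. f (\<omega>, x) \<partial>\<kappa> \<omega>)" if "\<omega> \<in> S" for \<omega>
    using f(2) by (intro nn_integral_eq_integral int that) auto
  \<comment> \<open>Measurability in the parameter is available for nonnegative fibre integrals;
    \<open>enn2real\<close> carries it over to the Bochner integral, which is the same number on
    \<open>S\<close>.\<close>
  have "(\<lambda>\<omega>. enn2real (\<integral>\<^sup>+x. ennreal (f (\<omega>, x)) \<partial>\<kappa> \<omega>)) \<in> borel_measurable ?R"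
    using nn_integral_measurable_subprob_algebra2[OF f' measurable_prob_algebraD[OF \<kappa>]] by simp
  then have meas: "(\<lambda>\<omega>. \<integral>x. f (\<omega>, x) \<partial>\<kappa> \<omega>) \<in> borel_measurable ?R"
    using f(2) by (subst (asm) measurable_cong[where g = "\<lambda>\<omega>. \<integral>x. f (\<omega>, x) \<partial>\<kappa> \<omega>"])
      (auto simp: space_R eq)
  show int_R: "integrable ?R (\<lambda>\<omega>. \<integral>x. f (\<omega>, x) \<partial>\<kappa> \<omega>)"
    using meas bound f(2) by (intro R.integrable_const_bound[where B = B]) (auto simp: space_R)
  have nn: "(\<integral>\<^sup>+z. ennreal (f z) \<partial>\<mu>) = ennreal (\<integral>\<omega>. (\<integral>x. f (\<omega>, x) \<partial>\<kappa> \<omega>) \<partial>?R)"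
  proof -
    have "(\<integral>\<^sup>+z. ennreal (f z) \<partial>\<mu>) = (\<integral>\<^sup>+\<omega>. (\<integral>\<^sup>+x. ennreal (f (\<omega>, x)) \<partial>\<kappa> \<omega>) \<partial>?R)"
      using f(1) by (intro nn_integral_disintegration[OF \<kappa> S fin sets_\<mu> rect]) auto
    also have "\<dots> = (\<integral>\<^sup>+\<omega>. ennreal (\<integral>x. f (\<omega>, x) \<partial>\<kappa> \<omega>) \<partial>?R)"
      by (intro nn_integral_cong eq) (simp add: space_R)
    also have "\<dots> = ennreal (\<integral>\<omega>. (\<integral>x. f (\<omega>, x) \<partial>\<kappa> \<omega>) \<partial>?R)"
      using f(2) by (intro nn_integral_eq_integral int_R) auto
    finally show ?thesis .
  qed
  have f_\<mu>: "f \<in> borel_measurable \<mu>" using f(1) measurable_cong_sets[OF sets_\<mu> refl] by blast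
  show "integrable \<mu> f"
    using f_\<mu> f(2) nn by (intro integrableI_nonneg) auto
  have "0 \<le> (\<integral>\<omega>. (\<integral>x. f (\<omega>, x) \<partial>\<kappa> \<omega>) \<partial>?R)" using f(2) by simp
  then show "(\<integral>z. f z \<partial>\<mu>) = (\<integral>\<omega>. (\<integral>x. f (\<omega>, x) \<partial>\<kappa> \<omega>) \<partial>?R)"
    using f_\<mu> f(2) nn by (subst integral_eq_nn_integral) auto
qed

text \<open>Positive and negative parts are both dominated by the absolute value, so
  \<open>B\<close> bounds the fibre integrals of each. Integrability over \<open>\<mu>\<close> is
  concluded as well, so the integral is not the default value 0 of a non-integrable
  function.\<close>

lemma integral_disintegration:
  fixes f :: "'a \<times> 'b \<Rightarrow> real"
  assumes \<kappa>: "\<kappa> \<in> measurable (restrict_space M S) (prob_algebra N)"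
    and S: "S \<in> sets M" "S \<noteq> {}"
    and fin: "finite_measure M"
    and sets_\<mu>: "sets \<mu> = sets (M \<Otimes>\<^sub>M N)"
    and rect: "\<And>A B. A \<in> sets M \<Longrightarrow> B \<in> sets N \<Longrightarrow>
           emeasure \<mu> (A \<times> B) = (\<integral>\<^sup>+\<omega>\<in>A \<inter> S. emeasure (\<kappa> \<omega>) B \<partial>M)"
    and f: "f \<in> borel_measurable (M \<Otimes>\<^sub>M N)"
    and int: "\<And>\<omega>. \<omega> \<in> S \<Longrightarrow> integrable (\<kappa> \<omega>) (\<lambda>x. f (\<omega>, x))"
    and bound: "\<And>\<omega>. \<omega> \<in> S \<Longrightarrow> (\<integral>x. \<bar>f (\<omega>, x)\<bar> \<partial>\<kappa> \<omega>) \<le> B"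
  shows "integrable \<mu> f"
    and "integrable (restrict_space M S) (\<lambda>\<omega>. \<integral>x. f (\<omega>, x) \<partial>\<kappa> \<omega>)"
    and "(\<integral>z. f z \<partial>\<mu>) = (\<integral>\<omega>. (\<integral>x. f (\<omega>, x) \<partial>\<kappa> \<omega>) \<partial>restrict_space M S)"
proof -
  let ?R = "restrict_space M S"
  define p where "p z = max (f z) 0" for z
  define q where "q z = max (- f z) 0" for z
  have pq: "f = (\<lambda>z. p z - q z)" by (auto simp: p_def q_def)
  have int_pq: "integrable (\<kappa> \<omega>) (\<lambda>x. p (\<omega>, x))" "integrable (\<kappa> \<omega>) (\<lambda>x. q (\<omega>, x))"
    if "\<omega> \<in> S" for \<omega>
    unfolding p_def q_def using int[OF that] by auto
  have bound_pq: "(\<integral>x. p (\<omega>, x) \<partial>\<kappa> \<omega>) \<le> B" "(\<integral>x. q (\<omega>, x) \<partial>\<kappa> \<omega>) \<le> B"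
    if "\<omega> \<in> S" for \<omega>
    using int_pq[OF that] int[OF that]
    by (auto intro!: order_trans[OF integral_mono bound[OF that]] simp: p_def q_def)
  have meas_pq: "p \<in> borel_measurable (M \<Otimes>\<^sub>M N)" "q \<in> borel_measurable (M \<Otimes>\<^sub>M N)"
    unfolding p_def q_def using f by auto
  have pq0: "0 \<le> p z" "0 \<le> q z" for z by (auto simp: p_def q_def)
  note P = integral_disintegration_nonneg[OF \<kappa> S fin sets_\<mu> rect meas_pq(1) pq0(1) int_pq(1) bound_pq(1)]
  note Q = integral_disintegration_nonneg[OF \<kappa> S fin sets_\<mu> rect meas_pq(2) pq0(2) int_pq(2) bound_pq(2)]
  have S_space: "S \<inter> space M = S"
    using S(1) sets.sets_into_space by (auto simp: Int_absorb2)
  have split: "(\<integral>x. f (\<omega>, x) \<partial>\<kappa> \<omega>) = (\<integral>x. p (\<omega>, x) \<partial>\<kappa> \<omega>) - (\<integral>x. q (\<omega>, x) \<partial>\<kappa> \<omega>)"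
    if "\<omega> \<in> space ?R" for \<omega>
  proof -
    have "\<omega> \<in> S" using that S_space by (auto simp: space_restrict_space)
    then show ?thesis
      unfolding pq by (intro Bochner_Integration.integral_diff int_pq)
  qed
  show "integrable \<mu> f"
    unfolding pq by (intro Bochner_Integration.integrable_diff P(1) Q(1))
  show "integrable ?R (\<lambda>\<omega>. \<integral>x. f (\<omega>, x) \<partial>\<kappa> \<omega>)"
    by (subst Bochner_Integration.integrable_cong[OF refl split], assumption)
       (intro Bochner_Integration.integrable_diff P(2) Q(2))
  show "(\<integral>z. f z \<partial>\<mu>) = (\<integral>\<omega>. (\<integral>x. f (\<omega>, x) \<partial>\<kappa> \<omega>) \<partial>?R)"
  proof -
    have "(\<integral>z. f z \<partial>\<mu>) = (\<integral>z. p z \<partial>\<mu>) - (\<integral>z. q z \<partial>\<mu>)"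
      unfolding pq by (intro Bochner_Integration.integral_diff P(1) Q(1))
    also have "\<dots> = (\<integral>\<omega>. (\<integral>x. p (\<omega>, x) \<partial>\<kappa> \<omega>) - (\<integral>x. q (\<omega>, x) \<partial>\<kappa> \<omega>) \<partial>?R)"
    proof -
      have "(\<integral>z. p z \<partial>\<mu>) = (\<integral>\<omega>. (\<integral>x. p (\<omega>, x) \<partial>\<kappa> \<omega>) \<partial>?R)"
        "(\<integral>z. q z \<partial>\<mu>) = (\<integral>\<omega>. (\<integral>x. q (\<omega>, x) \<partial>\<kappa> \<omega>) \<partial>?R)"
        by (rule P(3), assumption+) (rule Q(3), assumption+)
      moreover have "(\<integral>\<omega>. (\<integral>x. p (\<omega>, x) \<partial>\<kappa> \<omega>) - (\<integral>x. q (\<omega>, x) \<partial>\<kappa> \<omega>) \<partial>?R)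
          = (\<integral>\<omega>. (\<integral>x. p (\<omega>, x) \<partial>\<kappa> \<omega>) \<partial>?R) - (\<integral>\<omega>. (\<integral>x. q (\<omega>, x) \<partial>\<kappa> \<omega>) \<partial>?R)"
        by (intro Bochner_Integration.integral_diff P(2) Q(2))
      ultimately show ?thesis by (simp only:)
    qed
    also have "\<dots> = (\<integral>\<omega>. (\<integral>x. f (\<omega>, x) \<partial>\<kappa> \<omega>) \<partial>?R)"
      by (intro Bochner_Integration.integral_cong refl split[symmetric])
    finally show ?thesis .
  qed
qed

section \<open>Observables on the manifold\<close>

text \<open>Agreement on an open set is agreement near each of its points, hence the derivatives
  agree on that set too, and the induction can continue with them.\<close>

lemma Ck_on_cong:
  assumes "open S" "\<And>z. z \<in> S \<Longrightarrow> f z = g z" "Ck_on k S f"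
  shows "Ck_on k S g"
  using assms(2,3)
proof (induction k arbitrary: f g)
  case 0
  then show ?case by (metis Ck_on.simps(1) continuous_on_cong)
next
  case (Suc k)
  have deriv: "(g has_derivative frechet_derivative f (at z)) (at z)" if "z \<in> S" for z
    using Suc.prems that \<open>open S\<close>
    by (intro has_derivative_transform_within_open[of f _ z UNIV S g])
       (auto simp: frechet_derivative_works[symmetric])
  have eq: "frechet_derivative f (at z) v = frechet_derivative g (at z) v" if "z \<in> S" for z v
    using fun_cong[OF frechet_derivative_at[OF deriv[OF that]]] .
  have "Ck_on k S (\<lambda>z. frechet_derivative g (at z) (axis j 1))" for j
  proof (rule Suc.IH[OF eq])
    show "Ck_on k S (\<lambda>z. frechet_derivative f (at z) (axis j 1))"
      using Suc.prems(2) by simp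
  qed
  then show ?case using deriv unfolding Ck_on.simps differentiable_def by blast
qed

text \<open>Applied to the embedding of the reals into the complex numbers: \<open>\<Phi>\<close> is
  real, while C^r norms and distributions take complex functions. Taking partial derivatives
  commutes with \<open>T\<close>, but this is known on \<open>S\<close> only, whence the appeal to
  \<open>Ck_on_cong\<close>.\<close>

lemma Ck_on_bounded_linear:
  assumes "bounded_linear T" "open S" "Ck_on k S f"
  shows "Ck_on k S (\<lambda>z. T (f z))"
  using assms(3)
proof (induction k arbitrary: f)
  case 0
  then show ?case by (simp add: bounded_linear.continuous_on[OF assms(1)])
next
  case (Suc k)
  have deriv: "((\<lambda>z. T (f z)) has_derivative (\<lambda>v. T (frechet_derivative f (at z) v))) (at z)"
    if "z \<in> S" for z
    using Suc.prems that
    by (intro bounded_linear.has_derivative[OF assms(1)]) (auto simp: frechet_derivative_works[symmetric])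
  have eq: "T (frechet_derivative f (at z) v) = frechet_derivative (\<lambda>z. T (f z)) (at z) v"
    if "z \<in> S" for z v
    using fun_cong[OF frechet_derivative_at[OF deriv[OF that]]] .
  have "Ck_on k S (\<lambda>z. frechet_derivative (\<lambda>z. T (f z)) (at z) (axis j 1))" for j
  proof (rule Ck_on_cong[OF \<open>open S\<close> eq])
    show "Ck_on k S (\<lambda>z. T (frechet_derivative f (at z) (axis j 1)))"
      using Suc.prems by (intro Suc.IH) simp
  qed
  then show ?case using deriv unfolding Ck_on.simps differentiable_def by blast
qed

section \<open>Continuity of C^r functions and sup-norm bounds from C^r norms\<close>

lemma Ck_on_imp_continuous_on: "Ck_on k S f \<Longrightarrow> continuous_on S f"
  by (cases k)
     (auto simp: continuous_at_imp_continuous_on differentiable_imp_continuous_within)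

text \<open>\<open>iter_partial\<close> peels off the derivative taken last, \<open>Ck_on\<close>
  the one taken first. Splitting the list at its end lets the two recursions run together.\<close>

lemma iter_partial_snoc:
  "iter_partial (js @ [j]) f = iter_partial js (\<lambda>z. frechet_derivative f (at z) (axis j 1))"
  by (induction js) auto

lemma continuous_on_iter_partial:
  assumes "Ck_on k S f" "length js \<le> k"
  shows "continuous_on S (iter_partial js f)"
  using assms
proof (induction js arbitrary: f k rule: rev_induct)
  case Nil
  then show ?case by (simp add: Ck_on_imp_continuous_on)
next
  case (snoc j js)
  then show ?case by (cases k) (auto simp: iter_partial_snoc)
qed

lemma smooth_atlasD:
  assumes "smooth_atlas \<A>" "(U, x) \<in> \<A>"
  shows "open U" "open (x ` U)" "homeomorphism U (x ` U) x (inv_into U x)"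
  using assms by (auto simp: smooth_atlas_def)

lemma Cr_funs_bounded_linear:
  assumes "bounded_linear T" "smooth_atlas \<A>" "f \<in> Cr_funs \<A> r"
  shows "(\<lambda>p. T (f p)) \<in> Cr_funs \<A> r"
  unfolding Cr_funs_def
proof clarify
  fix U x assume Ux: "(U, x) \<in> \<A>"
  then have "Ck_on r (x ` U) (f \<circ> inv_into U x)"
    using assms(3) by (auto simp: Cr_funs_def)
  from Ck_on_bounded_linear[OF assms(1) smooth_atlasD(2)[OF assms(2) Ux] this]
  show "Ck_on r (x ` U) ((\<lambda>p. T (f p)) \<circ> inv_into U x)"
    by (simp add: o_def)
qed

lemma Cr_funs_continuous_on:
  assumes "smooth_atlas \<A>" "f \<in> Cr_funs \<A> r"
  shows "continuous_on UNIV f"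
proof -
  have "isCont f p" for p
  proof -
    have "p \<in> (\<Union>(U, x)\<in>\<A>. U)" using assms(1) by (simp add: smooth_atlas_def)
    then obtain U x where Ux: "(U, x) \<in> \<A>" "p \<in> U" by blast
    note chart = smooth_atlasD[OF assms(1) Ux(1)]
    have "continuous_on (x ` U) (f \<circ> inv_into U x)"
      using assms(2) Ux(1) by (intro Ck_on_imp_continuous_on[of r]) (auto simp: Cr_funs_def)
    then have "continuous_on U ((f \<circ> inv_into U x) \<circ> x)"
      by (rule continuous_on_compose[OF homeomorphism_cont1[OF chart(3)]])
    then have "continuous_on U f"
      by (rule continuous_on_eq) (simp add: homeomorphism_apply1[OF chart(3)])
    then show ?thesis using chart(1) Ux(2) by (simp add: continuous_on_eq_continuous_at)
  qed
  then show ?thesis by (simp add: continuous_on_eq_continuous_at)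
qed

lemma chart_coverD:
  assumes "chart_cover \<A> \<K>" "((U, x), K) \<in> \<K>"
  shows "(U, x) \<in> \<A>" "compact K" "K \<noteq> {}" "K \<subseteq> U"
  using assms by (auto simp: chart_cover_def)

text \<open>The summand of the empty list, over a compact set of the cover containing
  \<open>p\<close>, already dominates \<open>norm (f p)\<close>. The remaining summands are
  nonnegative because each is a supremum of norms of a continuous function over a nonempty compact
  set.\<close>

lemma norm_le_chart_Cr_norm:
  fixes \<A> :: "('m::{t2_space, second_countable_topology}, 'n::finite) chart set"
  assumes atlas: "smooth_atlas \<A>" and cover: "chart_cover \<A> \<K>" and f: "f \<in> Cr_funs \<A> r"
  shows "norm (f p) \<le> chart_Cr_norm \<K> r f"
proof -
  define S where "S U x K js = (SUP z\<in>x ` K. norm (iter_partial js (f \<circ> inv_into U x) z))" 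
    for U K and x :: "'m \<Rightarrow> real ^ 'n" and js
  have upper: "norm (iter_partial js (f \<circ> inv_into U x) (x q)) \<le> S U x K js"
    if "((U, x), K) \<in> \<K>" "length js \<le> r" "q \<in> K" for U x K js q
  proof -
    note K = chart_coverD(1,2,4)[OF cover that(1)]
    note chart = smooth_atlasD[OF atlas K(1)]
    have cpt: "compact (x ` K)"
      by (rule compact_continuous_image[OF continuous_on_subset K(2)])
         (use chart(3) K(3) in \<open>auto simp: homeomorphism_def\<close>)
    have "continuous_on (x ` K) (iter_partial js (f \<circ> inv_into U x))"
      using f K that(2)
      by (intro continuous_on_subset[OF continuous_on_iter_partial[of r]]) (auto simp: Cr_funs_def)
    then have "bounded (iter_partial js (f \<circ> inv_into U x) ` x ` K)"
      by (rule compact_imp_bounded[OF compact_continuous_image[OF _ cpt]])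
    then obtain c where "\<And>z. z \<in> x ` K \<Longrightarrow> norm (iter_partial js (f \<circ> inv_into U x) z) \<le> c"
      by (auto simp: bounded_iff)
    then show ?thesis
      unfolding S_def using that(3) by (intro cSUP_upper bdd_aboveI2) auto
  qed
  have S0: "0 \<le> S U x K js" if "((U, x), K) \<in> \<K>" "length js \<le> r" for U x K js
  proof -
    have "K \<noteq> {}" by (rule chart_coverD(3)[OF cover that(1)])
    then obtain q where "q \<in> K" by blast
    then show ?thesis using upper[OF that] norm_ge_zero order_trans by blast
  qed
  have fin: "finite {js :: 'n list. length js \<le> r}"
    using finite_lists_length_le[of "UNIV :: 'n set" r] by simp
  obtain U x K where UxK: "((U, x), K) \<in> \<K>" "p \<in> K"
  proof -
    have "p \<in> (\<Union>(c, K)\<in>\<K>. K)" using cover by (simp add: chart_cover_def)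
    then show ?thesis using that by auto
  qed
  have "inv_into U x (x p) = p"
    using chart_coverD[OF cover UxK(1)] UxK(2)
    by (intro homeomorphism_apply1[OF smooth_atlasD(3)[OF atlas]]) auto
  then have "norm (f p) \<le> S U x K []"
    using upper[OF UxK(1) _ UxK(2), of "[]"] by simp
  also have "\<dots> \<le> (\<Sum>js\<in>{js. length js \<le> r}. S U x K js)"
    using fin S0[OF UxK(1)] by (intro member_le_sum) auto
  also have "\<dots> = (\<lambda>((U, x), K). \<Sum>js\<in>{js. length js \<le> r}. S U x K js) ((U, x), K)"
    by simp
  also have "\<dots> \<le> (\<Sum>((U, x), K)\<in>\<K>. \<Sum>js\<in>{js. length js \<le> r}. S U x K js)"
    using cover UxK(1) S0 by (intro member_le_sum) (auto simp: chart_cover_def intro!: sum_nonneg)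
  finally show ?thesis by (simp add: chart_Cr_norm_def S_def)
qed

lemma norm_le_Cr_norm:
  assumes "smooth_atlas \<A>" "Cr_norm \<A> r N"
  obtains c where "c \<ge> 0" "\<And>f p. f \<in> Cr_funs \<A> r \<Longrightarrow> norm (f p) \<le> c * N f"
proof -
  obtain \<K> c where \<K>: "chart_cover \<A> \<K>" "c > 0"
    and le: "\<And>f. f \<in> Cr_funs \<A> r \<Longrightarrow> c * chart_Cr_norm \<K> r f \<le> N f"
    using assms(2) unfolding Cr_norm_def by blast
  have "norm (f p) \<le> 1 / c * N f" if "f \<in> Cr_funs \<A> r" for f p
  proof -
    have "c * norm (f p) \<le> c * chart_Cr_norm \<K> r f"
      using \<K>(2) by (intro mult_left_mono norm_le_chart_Cr_norm[OF assms(1) \<K>(1) that]) auto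
    also have "\<dots> \<le> N f" by (rule le[OF that])
    finally show ?thesis using \<K>(2) by (simp add: field_simps)
  qed
  then show ?thesis using \<K>(2) by (intro that[of "1 / c"]) auto
qed

text \<open>The estimate for distributions does not apply to the absolute value, which may fail to
  be of class C^r. Its integral is bounded through the sup norm instead, as \<open>\<kappa>\<close>
  has mass 1.\<close>

lemma observable_of_distribution:
  fixes \<phi> :: "'m::{t2_space, second_countable_topology} \<Rightarrow> real"
    and \<A> :: "('m, 'n::finite) chart set"
  assumes atlas: "smooth_atlas \<A>"
    and c: "\<And>f p. f \<in> Cr_funs \<A> r \<Longrightarrow> norm (f p) \<le> c * N f"
    and \<phi>: "\<phi> \<in> Cr_funs \<A> r"
    and \<kappa>: "prob_space \<kappa>" "sets \<kappa> = sets borel"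
  shows "integrable \<kappa> \<phi>" "(\<integral>x. \<bar>\<phi> x\<bar> \<partial>\<kappa>) \<le> c * N (\<lambda>x. complex_of_real (\<phi> x))"
proof -
  interpret prob_space \<kappa> by fact
  have "(\<lambda>x. complex_of_real (\<phi> x)) \<in> Cr_funs \<A> r"
    by (intro Cr_funs_bounded_linear[OF bounded_linear_of_real atlas \<phi>])
  from c[OF this] have bound: "\<bar>\<phi> x\<bar> \<le> c * N (\<lambda>x. complex_of_real (\<phi> x))" for x
    by simp
  have "\<phi> \<in> borel_measurable borel"
    by (intro borel_measurable_continuous_onI Cr_funs_continuous_on[OF atlas \<phi>])
  then have "\<phi> \<in> borel_measurable \<kappa>"
    using measurable_cong_sets[OF \<kappa>(2) refl] by blast
  then show int: "integrable \<kappa> \<phi>"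
    using bound by (intro integrable_const_bound) auto
  show "(\<integral>x. \<bar>\<phi> x\<bar> \<partial>\<kappa>) \<le> c * N (\<lambda>x. complex_of_real (\<phi> x))"
    using integral_mono[OF integrable_abs[OF int] integrable_const, OF bound] by (simp add: prob_space)
qed

lemma function_realization_norm_le:
  assumes "function_realization m fn"
  shows "norm (fn a x) \<le> norm a"
proof -
  have "bounded (range (fn a))" "(SUP x. norm (fn a x)) \<le> norm a"
    using assms by (auto simp: function_realization_def)
  moreover from this(1) have "bdd_above (range (\<lambda>x. norm (fn a x)))"
    by (auto simp: bounded_iff bdd_above_def)
  ultimately show ?thesis using cSUP_upper[of x UNIV "\<lambda>x. norm (fn a x)"] by simp
qed

text \<open>The weak norm dominates the sup norm, so densities are bounded and may be integrated
  against any function in L^1. By linearity of \<open>fn\<close>, the two integrals differ by an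
  integral against \<open>fn (a - b)\<close>, which is bounded by
  \<open>norm (a - b)\<close>.\<close>

lemma observable_of_density:
  fixes \<phi> :: "'m::topological_space \<Rightarrow> real" and a b :: "'w::banach"
  assumes fn: "function_realization m fn"
    and dens: "probability_density m (fn a)"
    and \<kappa>: "\<kappa> = density m (\<lambda>x. ennreal (Re (fn a x)))"
    and \<phi>: "integrable m \<phi>"
  shows "integrable \<kappa> \<phi>"
    and "(\<integral>x. \<bar>\<phi> x\<bar> \<partial>\<kappa>) \<le> norm a * (\<integral>x. \<bar>\<phi> x\<bar> \<partial>m)"
    and "\<bar>(\<integral>x. \<phi> x \<partial>\<kappa>) - Re (\<integral>x. complex_of_real (\<phi> x) * fn b x \<partial>m)\<bar>
           \<le> norm (a - b) * (\<integral>x. \<bar>\<phi> x\<bar> \<partial>m)"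
proof -
  have [measurable]: "fn a \<in> borel_measurable m" for a
    using fn by (auto simp: function_realization_def)
  have [measurable]: "\<phi> \<in> borel_measurable m" using \<phi> by auto
  note le = function_realization_norm_le[OF fn]
  have re: "\<bar>Re (fn a x)\<bar> \<le> norm a" for a x
    using abs_Re_le_cmod le order_trans by blast
  \<comment> \<open>\<open>ennreal\<close> truncates negative numbers to 0, so
    \<open>\<kappa>\<close> has the real density \<open>Re (fn a x)\<close> only thanks to this
    sign.\<close>
  have pos: "AE x in m. 0 \<le> Re (fn a x)"
    using dens by (auto simp: probability_density_def elim: AE_mp)
  have int_abs: "integrable m (\<lambda>x. norm a * \<bar>\<phi> x\<bar>)" for a :: 'w
    using \<phi> by (intro integrable_mult_right integrable_abs)
  have intc: "integrable m (\<lambda>x. complex_of_real (\<phi> x) * fn a x)" for a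
    by (rule Bochner_Integration.integrable_bound[OF int_abs[of a]])
       (auto simp: norm_mult intro!: mult_mono le AE_I2 simp: mult.commute[of "norm a"])
  have int: "integrable m (\<lambda>x. Re (fn a x) * \<phi> x)" for a
    using integrable_Re[OF intc[of a]] by (simp add: mult.commute)
  show "integrable \<kappa> \<phi>"
    unfolding \<kappa> using int pos by (subst integrable_density) auto
  have "(\<integral>x. \<bar>\<phi> x\<bar> \<partial>\<kappa>) = (\<integral>x. Re (fn a x) * \<bar>\<phi> x\<bar> \<partial>m)"
    unfolding \<kappa> using pos by (subst integral_density) auto
  also have "\<dots> \<le> (\<integral>x. norm a * \<bar>\<phi> x\<bar> \<partial>m)"
  proof (rule integral_mono')
    show "Re (fn a x) * \<bar>\<phi> x\<bar> \<le> norm a * \<bar>\<phi> x\<bar>" for x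
      using re[of a x] by (intro mult_right_mono) auto
  qed (use int_abs in auto)
  finally show "(\<integral>x. \<bar>\<phi> x\<bar> \<partial>\<kappa>) \<le> norm a * (\<integral>x. \<bar>\<phi> x\<bar> \<partial>m)" by simp
  have fn_diff: "fn a x - fn b x = fn (a - b) x" for x
  proof -
    have "fn ((a - b) + b) x = fn (a - b) x + fn b x"
      using fn unfolding function_realization_def by blast
    then show ?thesis by (simp add: algebra_simps)
  qed
  have "(\<integral>x. \<phi> x \<partial>\<kappa>) = (\<integral>x. Re (fn a x) * \<phi> x \<partial>m)"
    unfolding \<kappa> using pos by (subst integral_density) auto
  moreover have "Re (\<integral>x. complex_of_real (\<phi> x) * fn b x \<partial>m) = (\<integral>x. Re (fn b x) * \<phi> x \<partial>m)"
    using integral_Re[OF intc[of b]] by (simp add: mult.commute)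
  ultimately have "(\<integral>x. \<phi> x \<partial>\<kappa>) - Re (\<integral>x. complex_of_real (\<phi> x) * fn b x \<partial>m)
      = (\<integral>x. Re (fn a x) * \<phi> x - Re (fn b x) * \<phi> x \<partial>m)"
    using int by simp
  also have "\<dots> = (\<integral>x. Re (fn (a - b) x) * \<phi> x \<partial>m)"
    by (simp add: fn_diff[symmetric] algebra_simps)
  also have "\<bar>\<dots>\<bar> \<le> (\<integral>x. \<bar>Re (fn (a - b) x) * \<phi> x\<bar> \<partial>m)"
    by (rule integral_abs_bound)
  also have "\<dots> \<le> (\<integral>x. norm (a - b) * \<bar>\<phi> x\<bar> \<partial>m)"
    by (intro integral_mono integrable_abs int int_abs)
      (auto simp: abs_mult intro!: mult_right_mono re)
  finally show "\<bar>(\<integral>x. \<phi> x \<partial>\<kappa>) - Re (\<integral>x. complex_of_real (\<phi> x) * fn b x \<partial>m)\<bar>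
      \<le> norm (a - b) * (\<integral>x. \<bar>\<phi> x\<bar> \<partial>m)" by simp
qed

section \<open>Convergence of the integrals\<close>

text \<open>After rescaling into the unit ball, \<open>f\<close> is one of the competitors in the
  supremum. The uniform bound \<open>bdd\<close> keeps that supremum genuine.\<close>

lemma tendsto_integral_of_dual_seminorm_diff:
  assumes F: "seminormed_observables F N" and "f \<in> F"
    and bdd: "bdd_above ((\<lambda>(\<epsilon>, f). \<bar>\<integral>\<omega>. f \<omega> \<partial>P \<epsilon>\<bar>) ` (I \<times> {f \<in> F. N f \<le> 1}))"
    and "\<epsilon>\<^sub>0 \<in> I"
    and lim: "((\<lambda>\<epsilon>. dual_seminorm_diff F N (P \<epsilon>) (P \<epsilon>\<^sub>0)) \<longlongrightarrow> 0) (at \<epsilon>\<^sub>0 within I)"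
  shows "((\<lambda>\<epsilon>. \<integral>\<omega>. f \<omega> \<partial>P \<epsilon>) \<longlongrightarrow> (\<integral>\<omega>. f \<omega> \<partial>P \<epsilon>\<^sub>0)) (at \<epsilon>\<^sub>0 within I)"
proof -
  \<comment> \<open>The maximum with 1 avoids dividing by 0 when the semi-norm of \<open>f\<close>
    vanishes.\<close>
  define s where "s = max 1 (N f)"
  define f' where "f' \<omega> = 1 / s * f \<omega>" for \<omega>
  have "s > 0" "N f \<le> s" by (auto simp: s_def)
  have "f' \<in> F" "N f' = \<bar>1 / s\<bar> * N f"
    using F \<open>f \<in> F\<close> unfolding seminormed_observables_def f'_def by blast+
  moreover from this(2) have "N f' = N f / s" using \<open>s > 0\<close> by simp
  ultimately have f': "f' \<in> {f \<in> F. N f \<le> 1}"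
    using \<open>s > 0\<close> \<open>N f \<le> s\<close> by simp
  obtain B where B: "\<bar>\<integral>\<omega>. k \<omega> \<partial>P \<epsilon>\<bar> \<le> B" if "\<epsilon> \<in> I" "k \<in> {f \<in> F. N f \<le> 1}" for \<epsilon> k
    using bdd by (fastforce simp: bdd_above_def)
  have le: "\<bar>(\<integral>\<omega>. f \<omega> \<partial>P \<epsilon>) - (\<integral>\<omega>. f \<omega> \<partial>P \<epsilon>\<^sub>0)\<bar> \<le> s * dual_seminorm_diff F N (P \<epsilon>) (P \<epsilon>\<^sub>0)"
    if "\<epsilon> \<in> I" for \<epsilon>
  proof -
    have "bdd_above ((\<lambda>k. \<bar>(\<integral>\<omega>. k \<omega> \<partial>P \<epsilon>) - (\<integral>\<omega>. k \<omega> \<partial>P \<epsilon>\<^sub>0)\<bar>) ` {f \<in> F. N f \<le> 1})"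
      using B[OF that] B[OF \<open>\<epsilon>\<^sub>0 \<in> I\<close>]
      by (intro bdd_aboveI2[of _ _ "B + B"] order_trans[OF abs_triangle_ineq4] add_mono) auto
    from cSUP_upper[OF f' this]
    have "\<bar>(\<integral>\<omega>. f' \<omega> \<partial>P \<epsilon>) - (\<integral>\<omega>. f' \<omega> \<partial>P \<epsilon>\<^sub>0)\<bar> \<le> dual_seminorm_diff F N (P \<epsilon>) (P \<epsilon>\<^sub>0)"
      by (simp add: dual_seminorm_diff_def)
    moreover have "(\<integral>\<omega>. f' \<omega> \<partial>P \<epsilon>) - (\<integral>\<omega>. f' \<omega> \<partial>P \<epsilon>\<^sub>0)
        = ((\<integral>\<omega>. f \<omega> \<partial>P \<epsilon>) - (\<integral>\<omega>. f \<omega> \<partial>P \<epsilon>\<^sub>0)) / s"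
      unfolding f'_def integral_mult_right_zero by (simp add: diff_divide_distrib)
    ultimately show ?thesis using \<open>s > 0\<close> by (simp add: abs_divide field_simps)
  qed
  have "\<forall>\<^sub>F \<epsilon> in at \<epsilon>\<^sub>0 within I. \<epsilon> \<in> I"
    by (simp add: eventually_at_filter)
  then have "\<forall>\<^sub>F \<epsilon> in at \<epsilon>\<^sub>0 within I. norm ((\<integral>\<omega>. f \<omega> \<partial>P \<epsilon>) - (\<integral>\<omega>. f \<omega> \<partial>P \<epsilon>\<^sub>0))
      \<le> s * dual_seminorm_diff F N (P \<epsilon>) (P \<epsilon>\<^sub>0)"
    by eventually_elim (use le in auto)
  moreover have "((\<lambda>\<epsilon>. s * dual_seminorm_diff F N (P \<epsilon>) (P \<epsilon>\<^sub>0)) \<longlongrightarrow> 0) (at \<epsilon>\<^sub>0 within I)"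
    by (rule tendsto_mult_right_zero[OF lim])
  ultimately show ?thesis
    by (rule LIM_zero_cancel[OF Lim_null_comparison])
qed

text \<open>Extending \<open>f\<close> by 0 outside \<open>S\<close> brings both integrals to
  \<open>M\<close>, where the pointwise estimate holds almost everywhere because \<open>A\<close>
  and \<open>S\<close> have full measure.\<close>

lemma integral_restrict_space_diff_le:
  fixes f g :: "'a \<Rightarrow> real"
  assumes "prob_space M"
    and S: "S \<in> sets M" "emeasure M S = 1"
    and A: "A \<in> sets M" "emeasure M A = 1"
    and f: "integrable (restrict_space M S) f" and g: "integrable M g"
    and le: "\<And>\<omega>. \<omega> \<in> A \<inter> S \<Longrightarrow> \<bar>f \<omega> - g \<omega>\<bar> \<le> e"
  shows "\<bar>(\<integral>\<omega>. f \<omega> \<partial>restrict_space M S) - (\<integral>\<omega>. g \<omega> \<partial>M)\<bar> \<le> e"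
proof -
  interpret prob_space M by fact
  have S': "S \<inter> space M \<in> sets M" using S(1) by auto
  define f' where "f' \<omega> = indicator S \<omega> *\<^sub>R f \<omega>" for \<omega>
  have f': "integrable M f'" "(\<integral>\<omega>. f \<omega> \<partial>restrict_space M S) = (\<integral>\<omega>. f' \<omega> \<partial>M)"
    using f unfolding f'_def integrable_restrict_space[OF S'] integral_restrict_space[OF S']
    by (simp_all add: set_integrable_def)
  have "AE \<omega> in M. \<omega> \<in> S" "AE \<omega> in M. \<omega> \<in> A"
    using S A by (simp_all add: AE_in_set_eq_1 measure_def)
  then have ae: "AE \<omega> in M. \<bar>f' \<omega> - g \<omega>\<bar> \<le> e"
    by eventually_elim (use le in \<open>auto simp: f'_def\<close>)
  have "\<bar>(\<integral>\<omega>. f' \<omega> \<partial>M) - (\<integral>\<omega>. g \<omega> \<partial>M)\<bar> = \<bar>\<integral>\<omega>. f' \<omega> - g \<omega> \<partial>M\<bar>"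
    using f'(1) g by simp
  also have "\<dots> \<le> (\<integral>\<omega>. \<bar>f' \<omega> - g \<omega>\<bar> \<partial>M)"
    by (rule integral_abs_bound)
  also have "\<dots> \<le> (\<integral>\<omega>. e \<partial>M)"
    using f'(1) g ae by (intro integral_mono_AE) auto
  finally show ?thesis by (simp add: f'(2) prob_space)
qed

theorem theorem2:
  fixes I :: "real set"
    and \<sigma> :: "real \<Rightarrow> 'a::metric_space \<Rightarrow> 'a"
    and P :: "real \<Rightarrow> 'a measure"
    and \<iota> :: "'s::banach \<Rightarrow> 'w::banach"
    and \<psi> :: "'w \<Rightarrow> complex"
    and Ls :: "'a \<Rightarrow> real \<Rightarrow> 's \<Rightarrow> 's"
    and Lw :: "'a \<Rightarrow> real \<Rightarrow> 'w \<Rightarrow> 'w"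
    and \<A> :: "('m::{t2_space, second_countable_topology}, 'n::finite) chart set"
    and g :: "('m, 'n) chart \<Rightarrow> 'm \<Rightarrow> real ^ 'n \<Rightarrow> real ^ 'n \<Rightarrow> real"
    and m :: "'m measure"
    and fn :: "'w \<Rightarrow> 'm \<Rightarrow> complex"
    and pair :: "'w \<Rightarrow> ('m \<Rightarrow> complex) \<Rightarrow> complex"
    and r :: nat
    and NCr :: "('m \<Rightarrow> complex) \<Rightarrow> real"
    and F :: "('a \<Rightarrow> real) set"
    and NF :: "('a \<Rightarrow> real) \<Rightarrow> real"
    and C lam \<zeta> :: real
    and \<Omega> :: "real \<Rightarrow> 'a set"
    and \<Omega>' :: "'a set"
    and h :: "'a \<Rightarrow> real \<Rightarrow> 's"
    and \<kappa> :: "'a \<Rightarrow> real \<Rightarrow> 'm measure"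
    and \<Phi> :: "'a \<times> 'm \<Rightarrow> real"
    and \<phi> \<theta> :: "'a \<Rightarrow> real"
    and \<mu> :: "real \<Rightarrow> ('a \<times> 'm) measure"
  \<comment> \<open>the base systems\<close>
  assumes "bounded (UNIV :: 'a set)"
    and "0 \<in> I" and "0 islimpt I"
    and "\<And>\<epsilon>. \<epsilon> \<in> I \<Longrightarrow> homeomorphism UNIV UNIV (\<sigma> \<epsilon>) (inv (\<sigma> \<epsilon>))"
    and "continuous_on (UNIV \<times> I) (\<lambda>(\<omega>, \<epsilon>). \<sigma> \<epsilon> \<omega>)"
    and "\<And>\<epsilon>. \<epsilon> \<in> I \<Longrightarrow> prob_space (P \<epsilon>) \<and> sets (P \<epsilon>) = sets borel"
    and "\<And>\<epsilon>. \<epsilon> \<in> I \<Longrightarrow> distr (P \<epsilon>) borel (\<sigma> \<epsilon>) = P \<epsilon>"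
  \<comment> \<open>the Banach spaces, the functional and the operators\<close>
    and "linear \<iota>" and "inj \<iota>" and "\<And>x. norm (\<iota> x) \<le> norm x"
    and "bounded_linear \<psi>" and "\<exists>x. \<psi> (\<iota> x) \<noteq> 0"
    and "\<And>\<omega> \<epsilon>. \<epsilon> \<in> I \<Longrightarrow> bounded_linear (Ls \<omega> \<epsilon>) \<and> bounded_linear (Lw \<omega> \<epsilon>)"
    and "\<And>\<omega> \<epsilon> x. \<epsilon> \<in> I \<Longrightarrow> \<iota> (Ls \<omega> \<epsilon> x) = Lw \<omega> \<epsilon> (\<iota> x)"
    and "\<And>\<omega> \<epsilon> x. \<epsilon> \<in> I \<Longrightarrow> \<psi> (Lw \<omega> \<epsilon> x) = \<psi> x"
  \<comment> \<open>the manifold\<close>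
    and "compact_riemannian_manifold \<A> g" and "normalized_volume \<A> g m"
  \<comment> \<open>the observables on the base\<close>
    and "seminormed_observables F NF"
    and "bdd_above ((\<lambda>(\<epsilon>, f). \<bar>\<integral>\<omega>. f \<omega> \<partial>P \<epsilon>\<bar>) ` (I \<times> {f \<in> F. NF f \<le> 1}))"
  \<comment> \<open>constants and invariant sets\<close>
    and "C > 0" and "lam > 0" and "0 < \<zeta>" and "\<zeta> \<le> 1"
    and "\<And>\<epsilon>. \<epsilon> \<in> I \<Longrightarrow> \<Omega> \<epsilon> \<in> sets borel \<and> \<sigma> \<epsilon> ` \<Omega> \<epsilon> = \<Omega> \<epsilon> \<and> emeasure (P \<epsilon>) (\<Omega> \<epsilon>) = 1"
  \<comment> \<open>decay, regularity in the parameters, and the equivariant families\<close>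
    and "\<And>x n \<epsilon> \<omega>. \<psi> x = 0 \<Longrightarrow> n \<ge> 1 \<Longrightarrow> \<epsilon> \<in> I \<Longrightarrow> \<omega> \<in> \<Omega> \<epsilon> \<Longrightarrow>
           norm (cocycle (\<sigma> \<epsilon>) (\<lambda>\<omega>. Lw \<omega> \<epsilon>) n \<omega> x) \<le> C * exp (- lam * real n) * norm x"
    and "\<And>\<epsilon> x \<omega> \<omega>'. \<epsilon> \<in> I \<Longrightarrow> \<omega> \<in> \<Omega> \<epsilon> \<Longrightarrow> \<omega>' \<in> \<Omega> 0 \<Longrightarrow>
           norm (Lw \<omega> \<epsilon> (\<iota> x) - Lw \<omega>' 0 (\<iota> x))
             \<le> C * (dist \<omega> \<omega>' powr \<zeta> + \<bar>\<epsilon>\<bar> powr \<zeta>) * norm x"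
    and "\<And>\<epsilon> \<omega>. \<epsilon> \<in> I \<Longrightarrow> \<omega> \<in> \<Omega> \<epsilon> \<Longrightarrow> \<psi> (\<iota> (h \<omega> \<epsilon>)) = 1 \<and> norm (h \<omega> \<epsilon>) \<le> C"
    and "\<And>\<epsilon> \<omega>. \<epsilon> \<in> I \<Longrightarrow> \<omega> \<in> \<Omega> \<epsilon> \<Longrightarrow> Ls \<omega> \<epsilon> (h \<omega> \<epsilon>) = h (\<sigma> \<epsilon> \<omega>) \<epsilon>"
    and "\<exists>K. K-lipschitz_on UNIV (inv (\<sigma> 0))"
  \<comment> \<open>the common set of full measure and the convergence of the base systems\<close>
    and "\<Omega>' \<in> sets borel"
    and "\<And>\<epsilon>. \<epsilon> \<in> I \<Longrightarrow> \<Omega>' \<subseteq> \<Omega> \<epsilon> \<and> emeasure (P \<epsilon>) \<Omega>' = 1"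
    and "((\<lambda>\<epsilon>. dual_seminorm_diff F NF (P \<epsilon>) (P 0)) \<longlongrightarrow> 0) (at 0 within I)"
    and "((\<lambda>\<epsilon>. dist_C0 (inv (\<sigma> 0)) (inv (\<sigma> \<epsilon>))) \<longlongrightarrow> 0) (at 0 within I)"
  \<comment> \<open>\<open>\<kappa> \<omega> \<epsilon>\<close> is \<open>h \<omega> \<epsilon>\<close> seen as a Borel probability measure; first case (E), then case (H)\<close>
    and "\<Phi> \<in> borel_measurable (borel \<Otimes>\<^sub>M borel)"
    and "(function_realization m fn \<and>
          (\<forall>\<epsilon>\<in>I. \<forall>\<omega>\<in>\<Omega> \<epsilon>.
             probability_density m (fn (\<iota> (h \<omega> \<epsilon>))) \<and>
             \<kappa> \<omega> \<epsilon> = density m (\<lambda>x. ennreal (Re (fn (\<iota> (h \<omega> \<epsilon>)) x)))) \<and>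
          (\<forall>\<omega>. integrable m (\<lambda>x. \<Phi> (\<omega>, x))) \<and>
          (\<forall>\<omega>\<in>\<Omega> 0. complex_of_real (\<phi> \<omega>) =
             (\<integral>x. complex_of_real (\<Phi> (\<omega>, x)) * fn (\<iota> (h \<omega> 0)) x \<partial>m)) \<and>
          (\<forall>\<omega>. \<theta> \<omega> = (\<integral>x. \<bar>\<Phi> (\<omega>, x)\<bar> \<partial>m)))
       \<or> (Cr_norm \<A> r NCr \<and> distribution_realization \<A> r NCr pair \<and>
          (\<forall>\<epsilon>\<in>I. \<forall>\<omega>\<in>\<Omega> \<epsilon>.
             prob_space (\<kappa> \<omega> \<epsilon>) \<and> sets (\<kappa> \<omega> \<epsilon>) = sets borel \<and>
             (\<forall>f\<in>Cr_funs \<A> r. pair (\<iota> (h \<omega> \<epsilon>)) f = (\<integral>x. f x \<partial>\<kappa> \<omega> \<epsilon>))) \<and>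
          (\<forall>\<omega>. (\<lambda>x. \<Phi> (\<omega>, x)) \<in> Cr_funs \<A> r) \<and>
          (\<forall>\<omega>\<in>\<Omega> 0. complex_of_real (\<phi> \<omega>) =
             pair (\<iota> (h \<omega> 0)) (\<lambda>x. complex_of_real (\<Phi> (\<omega>, x)))) \<and>
          (\<forall>\<omega>. \<theta> \<omega> = NCr (\<lambda>x. complex_of_real (\<Phi> (\<omega>, x)))))"
    and "\<And>\<epsilon>. \<epsilon> \<in> I \<Longrightarrow>
           (\<lambda>\<omega>. \<kappa> \<omega> \<epsilon>) \<in> measurable (restrict_space borel (\<Omega> \<epsilon>)) (prob_algebra borel)"
    and "\<phi> \<in> F" and "\<theta> \<in> F"
  \<comment> \<open>the measures on the product\<close>
    and "\<And>\<epsilon>. \<epsilon> \<in> I \<Longrightarrow> sets (\<mu> \<epsilon>) = sets (borel \<Otimes>\<^sub>M borel)"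
    and "\<And>\<epsilon> A B. \<epsilon> \<in> I \<Longrightarrow> A \<in> sets borel \<Longrightarrow> B \<in> sets borel \<Longrightarrow>
           emeasure (\<mu> \<epsilon>) (A \<times> B) = (\<integral>\<^sup>+\<omega>\<in>A \<inter> \<Omega> \<epsilon>. emeasure (\<kappa> \<omega> \<epsilon>) B \<partial>P \<epsilon>)"
  shows "(\<forall>\<epsilon>\<in>I. integrable (\<mu> \<epsilon>) \<Phi>) \<and>
         ((\<lambda>\<epsilon>. \<integral>z. \<Phi> z \<partial>\<mu> \<epsilon>) \<longlongrightarrow> (\<integral>z. \<Phi> z \<partial>\<mu> 0)) (at 0 within I)"
proof -
  note zero = assms(2)
  define u where "u \<epsilon> \<omega> = \<iota> (h \<omega> \<epsilon>)" for \<epsilon> \<omega>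
  define c where "c \<epsilon> \<omega> = (\<integral>x. \<Phi> (\<omega>, x) \<partial>\<kappa> \<omega> \<epsilon>)" for \<epsilon> \<omega>
  have u_le: "norm (u \<epsilon> \<omega>) \<le> C" if "\<epsilon> \<in> I" "\<omega> \<in> \<Omega> \<epsilon>" for \<epsilon> \<omega>
    using order_trans[OF assms(10)] assms(27)[OF that] by (simp add: u_def)
  obtain K where K: "K-lipschitz_on UNIV (inv (\<sigma> 0))" using assms(29) by blast

  \<comment> \<open>Uniform weak convergence of the equivariant families\<close>
  have close: "\<forall>\<^sub>F \<epsilon> in at 0 within I. \<forall>\<omega>\<in>\<Omega> \<epsilon> \<inter> \<Omega> 0. norm (u \<epsilon> \<omega> - u 0 \<omega>) < e"
    if "e > 0" for e
  proof (rule equivariant_families_close[where L = "\<lambda>\<epsilon> \<omega>. Lw \<omega> \<epsilon>" and u = u and \<psi> = \<psi> and a = 1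
      and I = I and \<sigma> = \<sigma> and \<Omega> = \<Omega> and C = C and lam = lam and \<zeta> = \<zeta>])
    show "bounded (UNIV :: 'a set)" "0 \<in> I" "0 < C" "0 < lam" "0 < \<zeta>" "0 < e"
      "K-lipschitz_on UNIV (inv (\<sigma> 0))"
      "((\<lambda>\<epsilon>. dist_C0 (inv (\<sigma> 0)) (inv (\<sigma> \<epsilon>))) \<longlongrightarrow> 0) (at 0 within I)"
      by (fact assms(1) assms(2) assms(20) assms(21) assms(22) that K assms(33))+
    show "\<psi> (Lw \<omega> \<epsilon> x) = \<psi> x" if "\<epsilon> \<in> I" for \<omega> \<epsilon> x
      by (rule assms(15)[OF that])
    show "bij (\<sigma> \<epsilon>)" if "\<epsilon> \<in> I" for \<epsilon>
      using assms(4)[OF that]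
      by (intro bij_betw_byWitness[where f' = "inv (\<sigma> \<epsilon>)"]) (auto simp: homeomorphism_def)
    show "linear \<psi>" using assms(11) by (rule bounded_linear.linear)
    show "linear (Lw \<omega> 0)" for \<omega>
      using assms(13)[OF zero] by (intro bounded_linear.linear) blast
    show "\<sigma> \<epsilon> ` \<Omega> \<epsilon> = \<Omega> \<epsilon>" if "\<epsilon> \<in> I" for \<epsilon>
      using assms(24)[OF that] by blast
    show "norm (cocycle (\<sigma> 0) (\<lambda>\<omega>. Lw \<omega> 0) n \<omega> x) \<le> C * exp (- lam * real n) * norm x"
      if "\<psi> x = 0" "n \<ge> 1" "\<omega> \<in> \<Omega> 0" for x n \<omega>
      by (rule assms(25)[OF that(1,2) zero that(3)])
    show "norm (Lw \<omega> \<epsilon> (u \<epsilon> \<omega>) - Lw \<omega>' 0 (u \<epsilon> \<omega>))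
        \<le> C * (dist \<omega> \<omega>' powr \<zeta> + \<bar>\<epsilon>\<bar> powr \<zeta>) * C"
      if "\<epsilon> \<in> I" "\<omega> \<in> \<Omega> \<epsilon>" "\<omega>' \<in> \<Omega> 0" for \<epsilon> \<omega> \<omega>'
      unfolding u_def using assms(27)[OF that(1,2)] assms(20)
      by (intro order_trans[OF assms(26)[OF that]] mult_left_mono) auto
    show "\<psi> (u \<epsilon> \<omega>) = 1 \<and> norm (u \<epsilon> \<omega>) \<le> C" if "\<epsilon> \<in> I" "\<omega> \<in> \<Omega> \<epsilon>" for \<epsilon> \<omega>
      using assms(27)[OF that] u_le[OF that] by (simp add: u_def)
    show "Lw \<omega> \<epsilon> (u \<epsilon> \<omega>) = u \<epsilon> (\<sigma> \<epsilon> \<omega>)" if "\<epsilon> \<in> I" "\<omega> \<in> \<Omega> \<epsilon>" for \<epsilon> \<omega>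
      unfolding u_def by (simp only: assms(14)[OF that(1), symmetric] assms(28)[OF that])
  qed

  \<comment> \<open>Fibre estimates in the cases (E) and (H)\<close>
  have F: "f \<in> borel_measurable borel" "bounded (range f)" if "f \<in> F" for f
    using assms(18) that by (auto simp: seminormed_observables_def)
  \<comment> \<open>Members of \<open>F\<close> are bounded, so \<open>T\<close> bounds the L^1
    norms, respectively C^r norms, of all fibres of \<open>\<Phi>\<close> at once.\<close>
  obtain T where T_abs: "\<And>\<omega>. \<bar>\<theta> \<omega>\<bar> \<le> T"
    using F(2)[OF assms(38)] by (auto simp: bounded_iff)
  have T: "\<theta> \<omega> \<le> T" "0 \<le> T" for \<omega>
    using T_abs[of \<omega>] by linarith+
  have prob_\<kappa>: "prob_space (\<kappa> \<omega> \<epsilon>)" "sets (\<kappa> \<omega> \<epsilon>) = sets borel" if "\<epsilon> \<in> I" "\<omega> \<in> \<Omega> \<epsilon>" for \<epsilon> \<omega>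
    using measurable_space[OF assms(36)[OF that(1)], of \<omega>] that(2)
    by (auto simp: space_restrict_space space_prob_algebra)

  \<comment> \<open>Both cases are reduced to two constants: \<open>B\<close> serves the
    disintegration, and \<open>D\<close> turns weak distance of the families into distance of fibre
    integrals.\<close>
  obtain B D where "0 \<le> D"
    and obs: "\<And>\<epsilon> \<omega>. \<epsilon> \<in> I \<Longrightarrow> \<omega> \<in> \<Omega> \<epsilon> \<Longrightarrow>
      integrable (\<kappa> \<omega> \<epsilon>) (\<lambda>x. \<Phi> (\<omega>, x)) \<and> (\<integral>x. \<bar>\<Phi> (\<omega>, x)\<bar> \<partial>\<kappa> \<omega> \<epsilon>) \<le> B"
    and diff: "\<And>\<epsilon> \<omega>. \<epsilon> \<in> I \<Longrightarrow> \<omega> \<in> \<Omega> \<epsilon> \<Longrightarrow> \<omega> \<in> \<Omega> 0 \<Longrightarrow>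
      \<bar>c \<epsilon> \<omega> - \<phi> \<omega>\<bar> \<le> D * norm (u \<epsilon> \<omega> - u 0 \<omega>)"
    using assms(35)
  proof (elim disjE conjE)
    assume fn: "function_realization m fn"
      and \<kappa>: "\<forall>\<epsilon>\<in>I. \<forall>\<omega>\<in>\<Omega> \<epsilon>. probability_density m (fn (\<iota> (h \<omega> \<epsilon>))) \<and>
             \<kappa> \<omega> \<epsilon> = density m (\<lambda>x. ennreal (Re (fn (\<iota> (h \<omega> \<epsilon>)) x)))"
      and \<Phi>: "\<forall>\<omega>. integrable m (\<lambda>x. \<Phi> (\<omega>, x))"
      and \<phi>: "\<forall>\<omega>\<in>\<Omega> 0. complex_of_real (\<phi> \<omega>) =
             (\<integral>x. complex_of_real (\<Phi> (\<omega>, x)) * fn (\<iota> (h \<omega> 0)) x \<partial>m)"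
      and \<theta>: "\<forall>\<omega>. \<theta> \<omega> = (\<integral>x. \<bar>\<Phi> (\<omega>, x)\<bar> \<partial>m)"
    show thesis
    \<comment> \<open>The first value instantiates \<open>D\<close>, which occurs first in
      \<open>0 \<le> D\<close>, and the second one \<open>B\<close>; likewise in case (H).\<close>
    proof (rule that[of T "C * T"])
      fix \<epsilon> \<omega> assume \<epsilon>: "\<epsilon> \<in> I" "\<omega> \<in> \<Omega> \<epsilon>"
      note dens = \<kappa>[rule_format, OF \<epsilon>, folded u_def]
      note D = observable_of_density[OF fn conjunct1[OF dens] conjunct2[OF dens] \<Phi>[rule_format],
          unfolded \<theta>[rule_format, symmetric]]
      have "(\<integral>x. \<bar>\<Phi> (\<omega>, x)\<bar> \<partial>\<kappa> \<omega> \<epsilon>) \<le> norm (u \<epsilon> \<omega>) * \<theta> \<omega>" by (rule D(2))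
      also have "\<dots> \<le> norm (u \<epsilon> \<omega>) * T" by (intro mult_left_mono T) simp
      also have "\<dots> \<le> C * T" by (intro mult_right_mono T u_le \<epsilon>)
      finally show "integrable (\<kappa> \<omega> \<epsilon>) (\<lambda>x. \<Phi> (\<omega>, x)) \<and> (\<integral>x. \<bar>\<Phi> (\<omega>, x)\<bar> \<partial>\<kappa> \<omega> \<epsilon>) \<le> C * T"
        using D(1) by blast
      assume \<omega>: "\<omega> \<in> \<Omega> 0"
      have "\<phi> \<omega> = Re (\<integral>x. complex_of_real (\<Phi> (\<omega>, x)) * fn (u 0 \<omega>) x \<partial>m)"
        unfolding u_def using \<phi>[rule_format, OF \<omega>] by (metis Re_complex_of_real)
      then have "\<bar>c \<epsilon> \<omega> - \<phi> \<omega>\<bar> \<le> norm (u \<epsilon> \<omega> - u 0 \<omega>) * \<theta> \<omega>"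
        unfolding c_def using D(3) by presburger
      also have "\<dots> \<le> norm (u \<epsilon> \<omega> - u 0 \<omega>) * T" by (intro mult_left_mono T) simp
      finally show "\<bar>c \<epsilon> \<omega> - \<phi> \<omega>\<bar> \<le> T * norm (u \<epsilon> \<omega> - u 0 \<omega>)" by (simp add: mult.commute)
    qed (rule T)
  next
    assume N: "Cr_norm \<A> r NCr" and pair: "distribution_realization \<A> r NCr pair"
      and \<kappa>: "\<forall>\<epsilon>\<in>I. \<forall>\<omega>\<in>\<Omega> \<epsilon>. prob_space (\<kappa> \<omega> \<epsilon>) \<and> sets (\<kappa> \<omega> \<epsilon>) = sets borel \<and>
             (\<forall>f\<in>Cr_funs \<A> r. pair (\<iota> (h \<omega> \<epsilon>)) f = (\<integral>x. f x \<partial>\<kappa> \<omega> \<epsilon>))"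
      and \<Phi>: "\<forall>\<omega>. (\<lambda>x. \<Phi> (\<omega>, x)) \<in> Cr_funs \<A> r"
      and \<phi>: "\<forall>\<omega>\<in>\<Omega> 0. complex_of_real (\<phi> \<omega>) =
             pair (\<iota> (h \<omega> 0)) (\<lambda>x. complex_of_real (\<Phi> (\<omega>, x)))"
      and \<theta>: "\<forall>\<omega>. \<theta> \<omega> = NCr (\<lambda>x. complex_of_real (\<Phi> (\<omega>, x)))"
    have atlas: "smooth_atlas \<A>"
      using assms(16) by (simp add: compact_riemannian_manifold_def)
    obtain b where b: "b \<ge> 0" "\<And>f p. f \<in> Cr_funs \<A> r \<Longrightarrow> norm (f p) \<le> b * NCr f"
      by (rule norm_le_Cr_norm[OF atlas N]) (rule that)
    obtain C' where C': "C' > 0"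
      "\<And>a f. f \<in> Cr_funs \<A> r \<Longrightarrow> norm (pair a f) \<le> C' * norm a * NCr f"
      using pair unfolding distribution_realization_def by blast
    show thesis
    proof (rule that[of "C' * T" "b * T"])
      fix \<epsilon> \<omega> assume \<epsilon>: "\<epsilon> \<in> I" "\<omega> \<in> \<Omega> \<epsilon>"
      note D = observable_of_distribution[where N = NCr, OF atlas b(2) \<Phi>[rule_format] prob_\<kappa>[OF \<epsilon>],
          unfolded \<theta>[rule_format, symmetric]]
      have "(\<integral>x. \<bar>\<Phi> (\<omega>, x)\<bar> \<partial>\<kappa> \<omega> \<epsilon>) \<le> b * \<theta> \<omega>" by (rule D(2))
      also have "\<dots> \<le> b * T" by (intro mult_left_mono T b)
      finally show "integrable (\<kappa> \<omega> \<epsilon>) (\<lambda>x. \<Phi> (\<omega>, x)) \<and> (\<integral>x. \<bar>\<Phi> (\<omega>, x)\<bar> \<partial>\<kappa> \<omega> \<epsilon>) \<le> b * T"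
        using D(1) by blast
      assume \<omega>: "\<omega> \<in> \<Omega> 0"
      let ?f = "\<lambda>x. complex_of_real (\<Phi> (\<omega>, x))"
      have f: "?f \<in> Cr_funs \<A> r"
        by (rule Cr_funs_bounded_linear[OF bounded_linear_of_real atlas \<Phi>[rule_format]])
      have "complex_of_real (c \<epsilon> \<omega>) = pair (u \<epsilon> \<omega>) ?f"
        unfolding c_def u_def using \<kappa> \<epsilon> f by simp
      moreover have "complex_of_real (\<phi> \<omega>) = pair (u 0 \<omega>) ?f"
        unfolding u_def by (rule \<phi>[rule_format, OF \<omega>])
      moreover have "pair (u \<epsilon> \<omega>) ?f = pair (u \<epsilon> \<omega> - u 0 \<omega>) ?f + pair (u 0 \<omega>) ?f"
      proof -
        have "pair ((u \<epsilon> \<omega> - u 0 \<omega>) + u 0 \<omega>) ?f = pair (u \<epsilon> \<omega> - u 0 \<omega>) ?f + pair (u 0 \<omega>) ?f"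
          using pair f unfolding distribution_realization_def by blast
        then show ?thesis by simp
      qed
      ultimately have "complex_of_real (c \<epsilon> \<omega> - \<phi> \<omega>) = pair (u \<epsilon> \<omega> - u 0 \<omega>) ?f"
        by simp
      then have "\<bar>c \<epsilon> \<omega> - \<phi> \<omega>\<bar> = norm (pair (u \<epsilon> \<omega> - u 0 \<omega>) ?f)"
        by (metis norm_of_real)
      also have "\<dots> \<le> C' * norm (u \<epsilon> \<omega> - u 0 \<omega>) * \<theta> \<omega>"
        unfolding \<theta>[rule_format] by (rule C'(2)[OF f])
      also have "\<dots> \<le> C' * norm (u \<epsilon> \<omega> - u 0 \<omega>) * T"
        using C'(1) by (intro mult_left_mono T) auto
      finally show "\<bar>c \<epsilon> \<omega> - \<phi> \<omega>\<bar> \<le> C' * T * norm (u \<epsilon> \<omega> - u 0 \<omega>)"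
        by (simp add: mult.commute mult.left_commute)
    qed (use C'(1) T in simp)
  qed

  \<comment> \<open>Integrals over the product as iterated integrals\<close>
  have fibre: "integrable (\<mu> \<epsilon>) \<Phi>" "integrable (restrict_space (P \<epsilon>) (\<Omega> \<epsilon>)) (c \<epsilon>)"
    "(\<integral>z. \<Phi> z \<partial>\<mu> \<epsilon>) = (\<integral>\<omega>. c \<epsilon> \<omega> \<partial>restrict_space (P \<epsilon>) (\<Omega> \<epsilon>))" if \<epsilon>: "\<epsilon> \<in> I" for \<epsilon>
  proof -
    note P = assms(6)[OF \<epsilon>]
    have sets_P: "sets (P \<epsilon>) = sets borel" using P by blast
    have sets_prod: "sets (P \<epsilon> \<Otimes>\<^sub>M borel) = sets (borel \<Otimes>\<^sub>M (borel :: 'm measure))"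
      by (rule sets_pair_measure_cong[OF sets_P refl])
    have kern: "(\<lambda>\<omega>. \<kappa> \<omega> \<epsilon>) \<in> measurable (restrict_space (P \<epsilon>) (\<Omega> \<epsilon>)) (prob_algebra borel)"
      using assms(36)[OF \<epsilon>] measurable_cong_sets[OF sets_restrict_space_cong[OF sets_P] refl] by blast
    \<comment> \<open>\<open>\<Omega> \<epsilon>\<close> is nonempty because it has measure
      1.\<close>
    have S: "\<Omega> \<epsilon> \<in> sets (P \<epsilon>)" "\<Omega> \<epsilon> \<noteq> {}" using assms(24)[OF \<epsilon>] sets_P by auto
    have fin: "finite_measure (P \<epsilon>)" using P by (simp add: prob_space.finite_measure)
    have \<Phi>: "\<Phi> \<in> borel_measurable (P \<epsilon> \<Otimes>\<^sub>M borel)"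
      using assms(34) measurable_cong_sets[OF sets_prod refl] by blast
    have rect: "emeasure (\<mu> \<epsilon>) (A \<times> B) = (\<integral>\<^sup>+\<omega>\<in>A \<inter> \<Omega> \<epsilon>. emeasure (\<kappa> \<omega> \<epsilon>) B \<partial>P \<epsilon>)"
      if "A \<in> sets (P \<epsilon>)" "B \<in> sets borel" for A B
      using that sets_P by (intro assms(40)[OF \<epsilon>]) auto
    have int: "integrable (\<kappa> \<omega> \<epsilon>) (\<lambda>x. \<Phi> (\<omega>, x))" "(\<integral>x. \<bar>\<Phi> (\<omega>, x)\<bar> \<partial>\<kappa> \<omega> \<epsilon>) \<le> B"
      if "\<omega> \<in> \<Omega> \<epsilon>" for \<omega>
      using obs[OF \<epsilon> that] by blast+
    have sets_\<mu>: "sets (\<mu> \<epsilon>) = sets (P \<epsilon> \<Otimes>\<^sub>M borel)" using assms(39)[OF \<epsilon>] sets_prod by simp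
    note dis = integral_disintegration[OF kern S fin sets_\<mu> rect \<Phi> int]
    show "integrable (\<mu> \<epsilon>) \<Phi>" by (rule dis(1))
    show "integrable (restrict_space (P \<epsilon>) (\<Omega> \<epsilon>)) (c \<epsilon>)"
      unfolding c_def by (rule dis(2))
    show "(\<integral>z. \<Phi> z \<partial>\<mu> \<epsilon>) = (\<integral>\<omega>. c \<epsilon> \<omega> \<partial>restrict_space (P \<epsilon>) (\<Omega> \<epsilon>))"
      unfolding c_def by (rule dis(3))
  qed
  \<comment> \<open>\<open>\<phi>\<close> is tied to the family at parameter 0 on
    \<open>\<Omega> 0\<close> only. The set \<open>\<Omega>'\<close> makes this enough: it lies in
    both \<open>\<Omega> \<epsilon>\<close> and \<open>\<Omega> 0\<close> and has full measure for
    \<open>P \<epsilon>\<close>.\<close>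
  have near: "\<bar>(\<integral>z. \<Phi> z \<partial>\<mu> \<epsilon>) - (\<integral>\<omega>. \<phi> \<omega> \<partial>P \<epsilon>)\<bar> \<le> D * e"
    if \<epsilon>: "\<epsilon> \<in> I" and e: "\<And>\<omega>. \<omega> \<in> \<Omega> \<epsilon> \<inter> \<Omega> 0 \<Longrightarrow> norm (u \<epsilon> \<omega> - u 0 \<omega>) \<le> e" for \<epsilon> e
    unfolding fibre(3)[OF \<epsilon>]
  proof (rule integral_restrict_space_diff_le[where A = \<Omega>'])
    have P: "prob_space (P \<epsilon>)" "sets (P \<epsilon>) = sets borel" using assms(6)[OF \<epsilon>] by auto
    show "prob_space (P \<epsilon>)" by fact
    show "\<Omega> \<epsilon> \<in> sets (P \<epsilon>)" "emeasure (P \<epsilon>) (\<Omega> \<epsilon>) = 1"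
      using assms(24)[OF \<epsilon>] P(2) by auto
    show "\<Omega>' \<in> sets (P \<epsilon>)" "emeasure (P \<epsilon>) \<Omega>' = 1"
      using assms(30) assms(31)[OF \<epsilon>] P(2) by auto
    show "integrable (restrict_space (P \<epsilon>) (\<Omega> \<epsilon>)) (c \<epsilon>)" by (rule fibre(2)[OF \<epsilon>])
    obtain b where "\<And>\<omega>. norm (\<phi> \<omega>) \<le> b"
      using F(2)[OF assms(37)] by (auto simp: bounded_iff)
    then show "integrable (P \<epsilon>) \<phi>"
      using F(1)[OF assms(37)] measurable_cong_sets[OF P(2) refl]
      by (intro finite_measure.integrable_const_bound[OF prob_space.finite_measure[OF P(1)]]) auto
    fix \<omega> assume "\<omega> \<in> \<Omega>' \<inter> \<Omega> \<epsilon>"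
    then have \<omega>: "\<omega> \<in> \<Omega> \<epsilon>" "\<omega> \<in> \<Omega> 0" using assms(31)[OF zero] by auto
    have "D * norm (u \<epsilon> \<omega> - u 0 \<omega>) \<le> D * e"
      using \<omega> by (intro mult_left_mono e \<open>0 \<le> D\<close>) auto
    then show "\<bar>c \<epsilon> \<omega> - \<phi> \<omega>\<bar> \<le> D * e"
      using diff[OF \<epsilon> \<omega>] by linarith
  qed

  \<comment> \<open>Passage to the limit\<close>
  have lim_\<phi>: "((\<lambda>\<epsilon>. \<integral>\<omega>. \<phi> \<omega> \<partial>P \<epsilon>) \<longlongrightarrow> (\<integral>\<omega>. \<phi> \<omega> \<partial>P 0)) (at 0 within I)"
    by (rule tendsto_integral_of_dual_seminorm_diff[OF assms(18,37,19) zero assms(32)])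
  \<comment> \<open>For parameter 0 the two families coincide, so the estimate holds with error
    0.\<close>
  have at_zero: "(\<integral>z. \<Phi> z \<partial>\<mu> 0) = (\<integral>\<omega>. \<phi> \<omega> \<partial>P 0)"
    using near[OF zero, of 0] by simp
  have in_I: "\<forall>\<^sub>F \<epsilon> in at 0 within I. \<epsilon> \<in> I"
    by (simp add: eventually_at_filter)
  have "((\<lambda>\<epsilon>. (\<integral>z. \<Phi> z \<partial>\<mu> \<epsilon>) - (\<integral>\<omega>. \<phi> \<omega> \<partial>P \<epsilon>)) \<longlongrightarrow> 0) (at 0 within I)"
  proof (rule tendstoI)
    fix e :: real assume "e > 0"
    \<comment> \<open>\<open>D\<close> may be 0; dividing by \<open>D + 1\<close> is always possible
      and keeps \<open>D * (e / (D + 1))\<close> strictly below \<open>e\<close>.\<close>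
    then have "e / (D + 1) > 0" using \<open>0 \<le> D\<close> by simp
    from close[OF this] in_I
    show "\<forall>\<^sub>F \<epsilon> in at 0 within I. dist ((\<integral>z. \<Phi> z \<partial>\<mu> \<epsilon>) - (\<integral>\<omega>. \<phi> \<omega> \<partial>P \<epsilon>)) 0 < e"
    proof eventually_elim
      case (elim \<epsilon>)
      have "\<bar>(\<integral>z. \<Phi> z \<partial>\<mu> \<epsilon>) - (\<integral>\<omega>. \<phi> \<omega> \<partial>P \<epsilon>)\<bar> \<le> D * (e / (D + 1))"
        using elim by (intro near) (auto intro: less_imp_le)
      also have "\<dots> < e" using \<open>0 \<le> D\<close> \<open>e > 0\<close> by (simp add: field_simps)
      finally show ?case by simp
    qed
  qed
  from tendsto_add[OF this lim_\<phi>]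
  have "((\<lambda>\<epsilon>. \<integral>z. \<Phi> z \<partial>\<mu> \<epsilon>) \<longlongrightarrow> (\<integral>z. \<Phi> z \<partial>\<mu> 0)) (at 0 within I)"
    by (simp add: at_zero)
  then show ?thesis using fibre(1) by blast
qed

end
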